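(* Let $u(z)=\sum_{n=1}^\infty a_nz^{n+1}$ be holomorphic on $\Delta$ and of class $H^{3/2}$, i.e. $\sum_{n\ge1}n^3|a_n|^2<\infty$, and let $Q=u_{zzz}$. For $w\in\Delta$ put $\gamma_w(z)=\frac{z+w}{1+\bar wz}$, $Q_w=(Q\circ\gamma_w)(\gamma_w')^2$, and define $a_n^w$ ($n\ge2$) by $Q_w(z)=\sum_{n=2}^\infty(n^3-n)a_n^wz^{n-2}$. Then for every integer $j\ge2$, $$\iint_\Delta|a_j^w|^2\frac{4\,dx\,dy}{(1-|w|^2)^2}=\frac{2}{3(j^3-j)}\iint_\Delta|Q(w)|^2(1-|w|^2)^2\,dx\,dy=\frac{4\pi}{3(j^3-j)}\sum_{n=2}^\infty(n^3-n)|a_n|^2,$$ where $w=x+iy$.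
   Context: $\Delta=\{z\in\mathbb C:|z|<1\}$. *)

theory Defs
  imports "HOL-Complex_Analysis.Complex_Analysis"
begin

abbreviation unit_disc :: "complex set" where
  "unit_disc \<equiv> ball 0 1"

definition disc_aut :: "complex \<Rightarrow> complex \<Rightarrow> complex" where
  "disc_aut w z = (z + w) / (1 + cnj w * z)"

(* pullback of the quadratic differential Q dz^2 by disc_aut w *)
definition quad_pullback :: "(complex \<Rightarrow> complex) \<Rightarrow> complex \<Rightarrow> complex \<Rightarrow> complex" where
  "quad_pullback Q w z = Q (disc_aut w z) * (deriv (disc_aut w) z)^2"

(* For n >= 2, aw w n is the number a_n^w with
   Q_w(z) = sum over n >= 2 of (n^3 - n) a_n^w z^(n-2) on the disc; the sum is reindexed
   by n = m + 2, and the values aw w 0, aw w 1 are irrelevant. *)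
definition pullback_coeffs ::
    "(complex \<Rightarrow> complex) \<Rightarrow> (complex \<Rightarrow> nat \<Rightarrow> complex) \<Rightarrow> bool" where
  "pullback_coeffs Q aw \<longleftrightarrow>
     (\<forall>w\<in>unit_disc. \<forall>z\<in>unit_disc.
        (\<lambda>m. (of_nat (m + 2) ^ 3 - of_nat (m + 2)) * aw w (m + 2) * z ^ m)
          sums quad_pullback Q w z)"

lemma disc_aut_eq_Moebius: "disc_aut w = Moebius_function 0 (- w)"
  by (simp add: fun_eq_iff disc_aut_def Moebius_function_def)

lemma quad_pullback_holomorphic:
  assumes Q: "Q holomorphic_on unit_disc" and w: "w \<in> unit_disc"
  shows "quad_pullback Q w holomorphic_on unit_disc"
proof -
  have w': "norm (- w) < 1" using w by simp
  have hol: "disc_aut w holomorphic_on unit_disc"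
    unfolding disc_aut_eq_Moebius by (rule Moebius_function_holomorphic[OF w'])
  have img: "disc_aut w ` unit_disc \<subseteq> unit_disc"
    unfolding disc_aut_eq_Moebius using Moebius_function_norm_lt_1[OF w'] by auto
  have "(\<lambda>z. Q (disc_aut w z)) holomorphic_on unit_disc"
    using holomorphic_on_compose_gen[OF hol Q img] by (simp add: o_def)
  moreover have "deriv (disc_aut w) holomorphic_on unit_disc"
    by (rule holomorphic_deriv[OF hol]) simp
  ultimately show ?thesis
    unfolding quad_pullback_def by (intro holomorphic_on_mult holomorphic_on_power)
qed

(* The coefficients a_n^w exist for every holomorphic Q. *)
lemma pullback_coeffs_exist:
  assumes "Q holomorphic_on unit_disc"
  shows "\<exists>aw. pullback_coeffs Q aw"
proof -
  define c where "c w m = (deriv ^^ m) (quad_pullback Q w) 0 / fact m" for w m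
  define aw where "aw w n = c w (n - 2) / (of_nat n ^ 3 - of_nat n)" for w n
  have nz: "(of_nat (m + 2) ^ 3 - of_nat (m + 2) :: complex) \<noteq> 0" for m
  proof -
    have "(of_nat (m + 2) ^ 3 - of_nat (m + 2) :: complex) = of_nat ((m + 1) * (m + 2) * (m + 3))"
      by (simp add: algebra_simps power3_eq_cube)
    thus ?thesis by (metis of_nat_eq_0_iff mult_eq_0_iff add_is_0 one_neq_zero zero_neq_numeral)
  qed
  have "(\<lambda>m. (of_nat (m + 2) ^ 3 - of_nat (m + 2)) * aw w (m + 2) * z ^ m)
          sums quad_pullback Q w z" if "w \<in> unit_disc" "z \<in> unit_disc" for w z
  proof -
    have "(\<lambda>m. c w m * (z - 0) ^ m) sums quad_pullback Q w z"
      unfolding c_def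
      by (rule holomorphic_power_series[OF quad_pullback_holomorphic[OF assms that(1)] that(2)])
    moreover have "(of_nat (m + 2) ^ 3 - of_nat (m + 2)) * aw w (m + 2) = c w m" for m
      using nz[of m] unfolding aw_def by (simp del: of_nat_add)
    ultimately show ?thesis by simp
  qed
  thus ?thesis unfolding pullback_coeffs_def by blast
qed

end

(* Put k = j - 2, Q = sum c_m z^m and N_k = (k+1)(k+2)(k+3) = j^3 - j. Expanding Q at w and composing
   formal power series, the k-th Taylor coefficient N_k a_j^w of Q_w is (1 - |w|^2) times a series
   sum_m c_m D_km(w), where D_km(e^{it} w) = e^{i(m-k)t} D_km(w) and |D_km(w)| is the modulus of a real
   polynomial f_k in r = |w| (depending on m). Averaging over rotations and Parseval's identity on
   circles reduce the integral over the disc to the one-dimensional integrals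
   I_k = int_0^1 2 r f_k(r)^2 dr. Raising and lowering relations between f_k and f_{k+1} give
     d/dr (2 r (1 - r^2) f_k f_{k+1}) = 4 r ((k+1) f_{k+1}^2 - (k+4) f_k^2),
   hence (k+1) I_{k+1} = (k+4) I_k and, by induction from I_0 = 2 / N_m, I_k = N_k / (3 N_m). The case
   k = 0 is the integral of |Q|^2 (1 - |w|^2)^2. *)
theory Submission
  imports Defs
begin

text \<open>The value \<open>N_k / (3 N_m)\<close> is what Schur orthogonality predicts for the
  unitary action of the disc automorphisms on quadratic differentials with weight
  \<open>(1 - |z|^2)^2\<close>, in which \<open>z ^ m\<close> has squared norm
  \<open>2 pi / N_m\<close>; raising and lowering in k is the infinitesimal form of that action.
  Only its two radial identities enter, so that binomial identities and one-variable calculus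
  suffice. The factor \<open>1 - |w|^2\<close> in front of the series is exactly what the weight
  \<open>4 / (1 - |w|^2)^2\<close> cancels, which leaves \<open>|sum_m c_m D_km|^2\<close> to be
  integrated against Lebesgue measure. Sums and integrals are interchanged for nonnegative
  extended-real integrals; integrability of both integrands is read off afterwards from the finite
  value.\<close>

subsection \<open>Radial matrix coefficients\<close>

text \<open>Up to the factor \<open>1 - r\<^sup>2\<close>, \<open>radial_coeff k m r\<close> is the coefficient of \<open>z ^ k\<close> in the pullback of
  \<open>z ^ m dz\<^sup>2\<close> by \<open>disc_aut r\<close>. For \<open>i > m\<close> the truncated \<open>m - i\<close> is harmless, since then
  \<open>m choose i = 0\<close>.\<close>
definition radial_term :: "nat \<Rightarrow> nat \<Rightarrow> nat \<Rightarrow> real \<Rightarrow> real" where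
  "radial_term k m i r = real (m choose i) * real ((k + 3) choose (i + 3)) * (-1) ^ (k - i)
      * (1 - r\<^sup>2) ^ (i + 1) * r ^ (m - i) * r ^ (k - i)"

definition radial_coeff :: "nat \<Rightarrow> nat \<Rightarrow> real \<Rightarrow> real" where
  "radial_coeff k m r = (\<Sum>i\<le>k. radial_term k m i r)"

text \<open>Each term is a constant times \<open>(1 - r^2)^(i + 1) * r^(m + k - 2 i)\<close>, with
  logarithmic derivative \<open>(m + k - 2 i) / r - 2 (i + 1) r / (1 - r^2)\<close>. The factor
  \<open>r * (1 - r^2)\<close> clears both denominators, which keeps the identity valid at
  \<open>r = 0\<close> and \<open>r = 1\<close>.\<close>

lemma radial_term_deriv:
  assumes "i \<le> k"
  obtains D where "(radial_term k m i has_real_derivative D) (at r)"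
    "r * (1 - r\<^sup>2) * D =
       radial_term k m i r * ((real m + real k - 2 * real i) * (1 - r\<^sup>2) - 2 * (real i + 1) * r\<^sup>2)"
proof (cases "i \<le> m")
  case False
  then have "radial_term k m i = (\<lambda>r. 0)"
    by (simp add: radial_term_def fun_eq_iff)
  then show ?thesis using that[of 0] by simp
next
  case True
  define p q where "p = m - i" and "q = k - i"
  have m: "m = i + p" and k: "k = i + q" using True assms by (auto simp: p_def q_def)
  define C where "C = real (m choose i) * real ((k + 3) choose (i + 3)) * (-1) ^ q"
  have eq: "radial_term k m i = (\<lambda>r. C * (1 - r\<^sup>2) ^ (i + 1) * r ^ (p + q))"
    by (simp add: fun_eq_iff radial_term_def C_def p_def q_def power_add)
  define D where "D = C * (real (i + 1) * (1 - r\<^sup>2) ^ i * (- 2 * r) * r ^ (p + q)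
      + (1 - r\<^sup>2) ^ (i + 1) * (real (p + q) * r ^ (p + q - 1)))"
  have deriv: "(radial_term k m i has_real_derivative D) (at r)"
    unfolding eq D_def
    by (rule derivative_eq_intros refl | simp)+ (simp add: algebra_simps)
  have rr: "r * (real (p + q) * r ^ (p + q - 1)) = real (p + q) * r ^ (p + q)"
    by (cases "p + q") auto
  have "r * (1 - r\<^sup>2) * D = C * (real (i + 1) * (1 - r\<^sup>2) ^ (i+1) * (- 2 * r\<^sup>2) * r ^ (p + q)
      + (1 - r\<^sup>2) ^ (i + 1) * (1 - r\<^sup>2) * (r * (real (p + q) * r ^ (p + q - 1))))"
    unfolding D_def by (simp add: algebra_simps power2_eq_square)
  also have "\<dots> = radial_term k m i r * ((real m + real k - 2 * real i) * (1 - r\<^sup>2) - 2 * (real i + 1) * r\<^sup>2)"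
    unfolding rr eq by (simp add: m k algebra_simps)
  finally have "r * (1 - r\<^sup>2) * D = radial_term k m i r * ((real m + real k - 2 * real i) * (1 - r\<^sup>2) - 2 * (real i + 1) * r\<^sup>2)" .
  with deriv show ?thesis by (rule that)
qed

lemma radial_coeff_deriv:
  obtains D where "(radial_coeff k m has_real_derivative D) (at r)"
    "r * (1 - r\<^sup>2) * D = (\<Sum>i\<le>k.
       radial_term k m i r * ((real m + real k - 2 * real i) * (1 - r\<^sup>2) - 2 * (real i + 1) * r\<^sup>2))"
proof -
  have "\<forall>i\<in>{..k}. \<exists>D. (radial_term k m i has_real_derivative D) (at r) \<and> r * (1 - r\<^sup>2) * D =
       radial_term k m i r * ((real m + real k - 2 * real i) * (1 - r\<^sup>2) - 2 * (real i + 1) * r\<^sup>2)"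
    by (metis atMost_iff radial_term_deriv)
  then obtain D where D: "\<And>i. i \<le> k \<Longrightarrow> (radial_term k m i has_real_derivative D i) (at r)"
     "\<And>i. i \<le> k \<Longrightarrow> r * (1 - r\<^sup>2) * D i =
       radial_term k m i r * ((real m + real k - 2 * real i) * (1 - r\<^sup>2) - 2 * (real i + 1) * r\<^sup>2)"
    by (metis atMost_iff)
  have "((\<lambda>r. \<Sum>i\<le>k. radial_term k m i r) has_real_derivative (\<Sum>i\<le>k. D i)) (at r)"
    by (intro DERIV_sum D) auto
  moreover have "r * (1 - r\<^sup>2) * (\<Sum>i\<le>k. D i) = (\<Sum>i\<le>k.
       radial_term k m i r * ((real m + real k - 2 * real i) * (1 - r\<^sup>2) - 2 * (real i + 1) * r\<^sup>2))"
    unfolding sum_distrib_left by (intro sum.cong) (auto simp: D(2))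
  ultimately show ?thesis using that by (simp add: radial_coeff_def[abs_def])
qed

text \<open>A weighted Pascal rule: term \<open>Suc i\<close> of level \<open>Suc k\<close> splits
  into the terms \<open>i\<close> and \<open>Suc i\<close> of level \<open>k\<close>. The weights
  are such that the second family lines up with the first after an index shift.\<close>

lemma radial_term_raise:
  assumes "i \<le> k"
  shows "(real k + 1) * r * radial_term (Suc k) m (Suc i) r =
    radial_term k m i r * (real m - real i) * (1 - r\<^sup>2) - radial_term k m (Suc i) r * (real i + real k + 5) * r\<^sup>2"
proof -
  \<comment> \<open>Pascal's rule reduces this to \<open>(i + 4) * ((k + 3) choose (i + 4)) = (k -
    i) * ((k + 3) choose (i + 3))\<close>.\<close>
  have B: "(real k + 1) * real (k + 4 choose (i + 4)) = (real i + 1) * real ((k + 3) choose (i + 3))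
     + (real i + real k + 5) * real ((k + 3) choose (i + 4))"
  proof -
    have "(k + 4 choose (i + 4)) = ((k + 3) choose (i + 3)) + ((k + 3) choose (i + 4))"
      using binomial_Suc_Suc[of "k+3" "i+3"] by (simp add: eval_nat_numeral)
    moreover have "(i + 4) * ((k + 3) choose (i + 4)) = (k - i) * ((k + 3) choose (i + 3))"
      using binomial_absorption[of "i+3" "k+3"] binomial_absorb_comp[of "k+3" "i+3"]
      by (simp add: eval_nat_numeral)
    then have "(real i + 4) * real ((k + 3) choose (i + 4)) = (real k - real i) * real ((k + 3) choose (i + 3))"
      by (metis (no_types, lifting) assms of_nat_add of_nat_diff of_nat_mult of_nat_numeral)
    ultimately show ?thesis by (simp add: algebra_simps)
  qed
  have A: "(real i + 1) * real (m choose (Suc i)) = (real m - real i) * real (m choose i)"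
  proof (cases "i \<le> m")
    case True
    have "Suc i * (m choose (Suc i)) = (m - i) * (m choose i)"
      using binomial_absorption[of i m] binomial_absorb_comp[of m i] by simp
    then show ?thesis using True 
      by (metis (no_types, lifting) of_nat_Suc of_nat_diff of_nat_mult add.commute)
  qed (simp add: binomial_eq_0)
  \<comment> \<open>Only in the last case are both exponents \<open>m - Suc i\<close> and
    \<open>k - Suc i\<close> genuine. If \<open>m \<le> i\<close>, both sides vanish; if
    \<open>i = k\<close>, the binomial \<open>(k + 3) choose (k + 4)\<close> removes the last
    term.\<close>
  consider "m \<le> i" | "i < m" "i = k" | "i < m" "i < k" using assms by linarith
  then show ?thesis
  proof cases
    case 1
    then show ?thesis by (cases "m = i") (auto simp: radial_term_def binomial_eq_0)
  next
    case 2
    define p where "p = m - Suc i"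
    have m: "m = i + 1 + p" using 2 by (simp add: p_def)
    define c1 c4 s where "c1 = real (m choose k)" and "c4 = real (m choose Suc k)" and "s = 1 - r\<^sup>2"
    have 1: "radial_term (Suc k) m (Suc i) r = c4 * s ^ (k + 2) * r ^ p"
      "radial_term k m i r = c1 * s ^ (k + 1) * r ^ Suc p" "radial_term k m (Suc i) r = 0"
      using 2 m by (simp_all add: radial_term_def c1_def c4_def s_def del: binomial_Suc_Suc)
    have "(real k + 1) * r * radial_term (Suc k) m (Suc i) r = ((real k + 1) * c4) * s ^ (k + 2) * r ^ Suc p"
      unfolding 1 by simp
    also have "(real k + 1) * c4 = (real m - real k) * c1"
      using A 2 by (simp add: c1_def c4_def)
    finally show ?thesis unfolding 1 using 2 by (simp add: s_def mult_ac)
  next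
    case 3
    define p q where "p = m - Suc i" and "q = k - Suc i"
    define c1 c2 c3 where "c1 = real (m choose i)" and "c2 = real ((k + 3) choose (i + 3))" and
      "c3 = real ((k + 3) choose (i + 4))"
    define c4 c5 where "c4 = real (m choose Suc i)" and "c5 = real ((k + 4) choose (i + 4))"
    have e: "m - i = Suc p" "k - i = Suc q" "m - Suc i = p" "k - Suc i = q"
      using 3 by (auto simp: p_def q_def)
    define s where "s = (1 - r\<^sup>2)"
    have 1: "radial_term (Suc k) m (Suc i) r = c4 * c5 * (-1)^Suc q * s ^ (i + 2) * r ^ p * r ^ Suc q"
      "radial_term k m i r = c1 * c2 * (-1)^Suc q * s ^ (i + 1) * r ^ Suc p * r ^ Suc q"
      "radial_term k m (Suc i) r = c4 * c3 * (-1)^q * s ^ (i + 2) * r ^ p * r ^ q"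
      using e by (simp_all add: radial_term_def c1_def c2_def c3_def c4_def c5_def s_def eval_nat_numeral)
    have "(real k + 1) * r * radial_term (Suc k) m (Suc i) r = 
        c4 * ((real k + 1) * c5) * (-1)^Suc q * s ^ (i + 2) * r ^ p * r ^ Suc q * r"
      unfolding 1 by (simp add: algebra_simps)
    also have "(real k + 1) * c5 = (real i + 1) * c2 + (real i + real k + 5) * c3"
      unfolding c5_def c2_def c3_def B ..
    also have "c4 * ((real i + 1) * c2 + (real i + real k + 5) * c3) = 
       ((real i + 1) * c4) * c2 + c4 * (real i + real k + 5) * c3" by (simp add: algebra_simps)
    also have "(real i + 1) * c4 = (real m - real i) * c1"
      unfolding c4_def c1_def A ..
    also have "((real m - real i) * c1 * c2 + c4 * (real i + real k + 5) * c3) * (- 1) ^ Suc q * s ^ (i + 2) * r ^ p * r ^ Suc q * r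
       = radial_term k m i r * (real m - real i) * s - radial_term k m (Suc i) r * (real i + real k + 5) * r\<^sup>2"
      unfolding 1 by (simp add: algebra_simps power2_eq_square)
    finally show ?thesis unfolding s_def .
  qed
qed

text \<open>With \<open>f\<^sub>k = radial_coeff k m\<close> and \<open>s = 1 - r\<^sup>2\<close>, substituting the derivative sum above
  turns the next two lemmas into the raising relation
  \<open>2 (k + 1) r f\<^sub>k\<^sub>+\<^sub>1 = r s f\<^sub>k' + ((m - k) s - 2 (k + 3) r\<^sup>2) f\<^sub>k\<close> and the lowering relation
  \<open>2 (k + 4) r f\<^sub>k = - r s f\<^sub>k\<^sub>+\<^sub>1' + ((m - k - 1) s - 2 (k + 2) r\<^sup>2) f\<^sub>k\<^sub>+\<^sub>1\<close>.\<close>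
lemma radial_coeff_raise_sum:
  "(real k + 1) * r * radial_coeff (Suc k) m r =
     (\<Sum>i\<le>k. radial_term k m i r * ((real m - real i) * (1 - r\<^sup>2) - (real i + real k + 4) * r\<^sup>2))"
proof -
  \<comment> \<open>The term \<open>i = 0\<close> of level \<open>Suc k\<close> has no left
    neighbour. Its value cancels the \<open>i = 0\<close> term that the index shift below leaves
    over.\<close>
  have 0: "(real k + 1) * r * radial_term (Suc k) m 0 r = - radial_term k m 0 r * (real k + 4) * r\<^sup>2"
  proof -
    have "(k+1) * ((k+4) choose 3) = (k+4) * ((k+3) choose 3)"
      using binomial_absorb_comp[of "k+4" 3] by (simp add: eval_nat_numeral)
    then have "(real k+1) * real ((k+4) choose 3) = (real k+4) * real ((k+3) choose 3)"
      by (metis (no_types, lifting) of_nat_1 of_nat_add of_nat_mult of_nat_numeral)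
    moreover have "radial_term (Suc k) m 0 r = real ((k+4) choose 3) * (- ((-1)^k * (1-r\<^sup>2) * r^m * r^k * r))"
      "radial_term k m 0 r = real ((k+3) choose 3) * ((-1)^k * (1-r\<^sup>2) * r^m * r^k)"
      by (simp_all add: radial_term_def eval_nat_numeral)
    ultimately show ?thesis
      by (simp add: power2_eq_square)
  qed
  have z: "radial_term k m (Suc k) r = 0" by (simp add: radial_term_def)
  have "(real k + 1) * r * radial_coeff (Suc k) m r = (real k + 1) * r * radial_term (Suc k) m 0 r
      + (\<Sum>i\<le>k. (real k + 1) * r * radial_term (Suc k) m (Suc i) r)"
    unfolding radial_coeff_def by (subst sum.atMost_Suc_shift) (simp add: algebra_simps sum_distrib_left)
  also have "(\<Sum>i\<le>k. (real k + 1) * r * radial_term (Suc k) m (Suc i) r) =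
      (\<Sum>i\<le>k. radial_term k m i r * (real m - real i) * (1 - r\<^sup>2) - radial_term k m (Suc i) r * (real (Suc i) + real k + 4) * r\<^sup>2)"
    by (intro sum.cong refl, subst radial_term_raise) (auto simp: add_ac)
  also have "\<dots> = (\<Sum>i\<le>k. radial_term k m i r * (real m - real i) * (1 - r\<^sup>2))
      - (\<Sum>i\<le>k. radial_term k m (Suc i) r * (real (Suc i) + real k + 4) * r\<^sup>2)"
    by (simp add: sum_subtractf)
  also have "(\<Sum>i\<le>k. radial_term k m (Suc i) r * (real (Suc i) + real k + 4) * r\<^sup>2) =
     (\<Sum>i\<le>Suc k. radial_term k m i r * (real i + real k + 4) * r\<^sup>2) - radial_term k m 0 r * (real k + 4) * r\<^sup>2"
    by (subst sum.atMost_Suc_shift) simp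
  also have "(\<Sum>i\<le>Suc k. radial_term k m i r * (real i + real k + 4) * r\<^sup>2) = 
      (\<Sum>i\<le>k. radial_term k m i r * (real i + real k + 4) * r\<^sup>2)" using z by simp
  finally have "(real k + 1) * r * radial_coeff (Suc k) m r =
      (\<Sum>i\<le>k. radial_term k m i r * (real m - real i) * (1 - r\<^sup>2))
      - (\<Sum>i\<le>k. radial_term k m i r * (real i + real k + 4) * r\<^sup>2)"
    unfolding 0 by simp
  also have "\<dots> = (\<Sum>i\<le>k. radial_term k m i r * ((real m - real i) * (1 - r\<^sup>2) - (real i + real k + 4) * r\<^sup>2))"
    unfolding sum_subtractf[symmetric] by (intro sum.cong refl) (simp add: algebra_simps)
  finally show ?thesis .
qed

lemma radial_coeff_lower_sum:
  "(real k + 4) * r * radial_coeff k m r =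
     - (\<Sum>i\<le>Suc k. radial_term (Suc k) m i r * (real k + 1 - real i))"
proof -
  have t: "(real k + 4) * r * radial_term k m i r = - (radial_term (Suc k) m i r * (real k + 1 - real i))"
    if i: "i \<le> k" for i
  proof -
    have "(k+1-i) * ((k+4) choose (i+3)) = (k+4) * ((k+3) choose (i+3))"
      using binomial_absorb_comp[of "k+4" "i+3"] by (simp add: eval_nat_numeral)
    then have B: "(real k+1-real i) * real ((k+4) choose (i+3)) = (real k+4) * real ((k+3) choose (i+3))"
      using i by (metis (no_types, lifting) of_nat_1 of_nat_add of_nat_mult of_nat_numeral of_nat_diff trans_le_add1)
    define X where "X = real (m choose i) * (-1)^(k-i) * (1-r\<^sup>2)^(i+1) * r^(m-i) * r^(k-i)"
    have "radial_term (Suc k) m i r = - real ((k+4) choose (i+3)) * X * r"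
      "radial_term k m i r = real ((k+3) choose (i+3)) * X"
      using i by (simp_all add: radial_term_def Suc_diff_le X_def) (simp add: add.commute)
    then have "(real k + 4) * r * radial_term k m i r = ((real k + 4) * real ((k+3) choose (i+3))) * (X * r)"
      "radial_term (Suc k) m i r * (real k + 1 - real i) = - (((real k+1-real i) * real ((k+4) choose (i+3))) * (X * r))"
      by (simp_all add: mult_ac)
    then show ?thesis using B by simp
  qed
  \<comment> \<open>The factor \<open>real k + 1 - real i\<close> vanishes at the top index, so both
    sums have the same range and can be compared term by term, without a shift.\<close>
  have "(\<Sum>i\<le>Suc k. radial_term (Suc k) m i r * (real k + 1 - real i)) =
     (\<Sum>i\<le>k. radial_term (Suc k) m i r * (real k + 1 - real i))" by simp
  then show ?thesis unfolding radial_coeff_def sum_distrib_left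
    by (simp add: t sum_negf del: sum.atMost_Suc)
qed

text \<open>Raising relation times \<open>f_(k+1)\<close> minus lowering relation times
  \<open>f_k\<close> leaves \<open>r s (f_k f_(k+1))' + (s - 2 r^2) f_k f_(k+1)\<close> with
  \<open>s = 1 - r^2\<close>. Since \<open>s - 2 r^2\<close> is the derivative of
  \<open>r s\<close>, this is the derivative of one product, whence the multiplier
  \<open>r * (1 - r^2)\<close>.\<close>

lemma radial_coeff_product_deriv:
  "((\<lambda>r. 2 * r * (1 - r\<^sup>2) * radial_coeff k m r * radial_coeff (Suc k) m r) has_real_derivative
      2 * (2 * (real k + 1) * r * (radial_coeff (Suc k) m r)\<^sup>2 - 2 * (real k + 4) * r * (radial_coeff k m r)\<^sup>2)) (at r)"
proof -
  obtain D where D: "(radial_coeff k m has_real_derivative D) (at r)"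
    "r * (1 - r\<^sup>2) * D = (\<Sum>i\<le>k.
       radial_term k m i r * ((real m + real k - 2 * real i) * (1 - r\<^sup>2) - 2 * (real i + 1) * r\<^sup>2))"
    by (rule radial_coeff_deriv)
  obtain E where E: "(radial_coeff (Suc k) m has_real_derivative E) (at r)"
    "r * (1 - r\<^sup>2) * E = (\<Sum>i\<le>Suc k.
       radial_term (Suc k) m i r * ((real m + real (Suc k) - 2 * real i) * (1 - r\<^sup>2) - 2 * (real i + 1) * r\<^sup>2))"
    by (rule radial_coeff_deriv)
  let ?f = "radial_coeff k m r" and ?g = "radial_coeff (Suc k) m r"
  have R: "2 * (real k + 1) * r * ?g = r * (1 - r\<^sup>2) * D + ((real m - real k) * (1 - r\<^sup>2) - 2 * (real k + 3) * r\<^sup>2) * ?f"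
  proof -
    have "r * (1 - r\<^sup>2) * D + ((real m - real k) * (1 - r\<^sup>2) - 2 * (real k + 3) * r\<^sup>2) * ?f =
       (\<Sum>i\<le>k. 2 * (radial_term k m i r * ((real m - real i) * (1 - r\<^sup>2) - (real i + real k + 4) * r\<^sup>2)))"
      unfolding D radial_coeff_def sum_distrib_left sum.distrib[symmetric]
      by (intro sum.cong refl) (simp add: algebra_simps)
    then show ?thesis unfolding sum_distrib_left[symmetric] radial_coeff_raise_sum[symmetric] by simp
  qed
  have L: "2 * (real k + 4) * r * ?f = - (r * (1 - r\<^sup>2) * E) + ((real m - real k - 1) * (1 - r\<^sup>2) - 2 * (real k + 2) * r\<^sup>2) * ?g"
  proof -
    have "- (r * (1 - r\<^sup>2) * E) + ((real m - real k - 1) * (1 - r\<^sup>2) - 2 * (real k + 2) * r\<^sup>2) * ?g =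
       (\<Sum>i\<le>Suc k. 2 * - (radial_term (Suc k) m i r * (real k + 1 - real i)))"
      unfolding E radial_coeff_def sum_distrib_left sum.distrib[symmetric] sum_negf[symmetric]
      by (intro sum.cong refl) (simp add: algebra_simps)
    also have "\<dots> = 2 * ((real k + 4) * r * ?f)"
      unfolding radial_coeff_lower_sum sum_distrib_left[symmetric] sum_negf ..
    finally show ?thesis by simp
  qed
  have 1: "2 * (2 * (real k + 1) * r * ?g\<^sup>2 - 2 * (real k + 4) * r * ?f\<^sup>2) =
     2 * ((2 * (real k + 1) * r * ?g) * ?g - (2 * (real k + 4) * r * ?f) * ?f)"
    by (simp add: power2_eq_square)
  show ?thesis unfolding 1 R L
    by (rule derivative_eq_intros D E refl | simp)+ (simp add: algebra_simps power2_eq_square)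
qed

lemma continuous_radial_coeff [continuous_intros]: "continuous_on A (radial_coeff k m)"
  unfolding radial_coeff_def[abs_def] radial_term_def[abs_def] by (intro continuous_intros)

text \<open>The primitive in \<open>radial_coeff_product_deriv\<close> vanishes at both ends of \<open>[0, 1]\<close>, so the
  integrals \<open>I\<^sub>k\<close> satisfy \<open>(k + 1) I\<^sub>k\<^sub>+\<^sub>1 = (k + 4) I\<^sub>k\<close>.\<close>
lemma radial_coeff_has_integral:
  "((\<lambda>r. 2 * r * (radial_coeff k m r)\<^sup>2) has_integral
      ((real k + 1) * (real k + 2) * (real k + 3) / (3 * ((real m + 1) * (real m + 2) * (real m + 3))))) {0..1}"
proof (induction k)
  case 0
  define P where "P n r = r ^ Suc n / real (Suc n)" for n and r :: real
  have P: "(P n has_real_derivative r ^ n) (at r)" for n r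
    unfolding P_def by (rule derivative_eq_intros refl | simp del: of_nat_Suc power_Suc)+
  define F where "F r = 2 * P (2 * m + 1) r - 4 * P (2 * m + 3) r + 2 * P (2 * m + 5) r" for r
  have f: "2 * r * (radial_coeff 0 m r)\<^sup>2 = 2 * r ^ (2 * m + 1) - 4 * r ^ (2 * m + 3) + 2 * r ^ (2 * m + 5)" for r
  proof -
    have p: "r ^ (2 * m + n) = (r ^ m)\<^sup>2 * r ^ n" for n
      by (simp add: power_add power_mult[symmetric] mult.commute)
    have c: "radial_coeff 0 m r = (1 - r\<^sup>2) * r ^ m"
      by (simp add: radial_coeff_def radial_term_def)
    show ?thesis unfolding p c
      by (simp add: algebra_simps eval_nat_numeral)
  qed
  have "(F has_real_derivative (2 * r * (radial_coeff 0 m r)\<^sup>2)) (at r)" for r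
    unfolding F_def f by (rule derivative_eq_intros P refl | simp)+
  then have "((\<lambda>r. 2 * r * (radial_coeff 0 m r)\<^sup>2) has_integral (F 1 - F 0)) {0..1}"
    by (intro fundamental_theorem_of_calculus)
      (auto simp: has_real_derivative_iff_has_vector_derivative[symmetric] intro: has_field_derivative_at_within)
  moreover have "F 1 - F 0 = 2 / ((real m + 1) * (real m + 2) * (real m + 3))"
  proof -
    have "P n 0 = 0" for n by (simp add: P_def)
    then have "F 0 = 0" by (simp add: F_def)
    moreover have "F 1 = 2 / ((real m + 1) * (real m + 2) * (real m + 3))"
      by (simp add: F_def P_def divide_simps) (simp add: algebra_simps)
    ultimately show ?thesis by simp
  qed
  ultimately show ?case by (simp add: mult.assoc)
next
  case (Suc k)
  let ?f = "radial_coeff k m" and ?g = "radial_coeff (Suc k) m"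
  let ?I = "(real k + 1) * (real k + 2) * (real k + 3) / (3 * ((real m + 1) * (real m + 2) * (real m + 3)))"
  have "((\<lambda>r. 2 * (2 * (real k + 1) * r * (?g r)\<^sup>2 - 2 * (real k + 4) * r * (?f r)\<^sup>2)) has_integral
     (2 * 1 * (1 - 1\<^sup>2) * ?f 1 * ?g 1 - 2 * 0 * (1 - 0\<^sup>2) * ?f 0 * ?g 0)) {0..1}"
    using radial_coeff_product_deriv
    by (intro fundamental_theorem_of_calculus)
      (auto simp: has_real_derivative_iff_has_vector_derivative[symmetric] intro: has_field_derivative_at_within)
  \<comment> \<open>Adding \<open>2 (k + 4)\<close> times the induction hypothesis cancels the part
    with \<open>radial_coeff k m\<close>, so integrability at level \<open>Suc k\<close> comes out
    together with the value.\<close>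
  from has_integral_add[OF this has_integral_mult_right[OF Suc, of "2 * (real k + 4)"]]
  have int: "((\<lambda>r. (2 * (real k + 1)) * (2 * r * (?g r)\<^sup>2)) has_integral 2 * (real k + 4) * ?I) {0..1}"
    by (simp add: algebra_simps)
  have cancel: "1 / (2 * (real k + 1)) * (2 * (real k + 1) * x) = x" for x
    by (simp add: field_simps)
  from has_integral_mult_right[OF int, of "1 / (2 * (real k + 1))"]
  have "((\<lambda>r. 2 * r * (?g r)\<^sup>2) has_integral (1 / (2 * (real k + 1)) * (2 * (real k + 4) * ?I))) {0..1}"
    unfolding cancel .
  moreover have "1 / (2 * (real k + 1)) * (2 * (real k + 4) * ?I) = 
    (real (Suc k) + 1) * (real (Suc k) + 2) * (real (Suc k) + 3) / (3 * ((real m + 1) * (real m + 2) * (real m + 3)))"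
    by (simp add: divide_simps) (simp add: algebra_simps)
  ultimately show ?case by simp
qed

subsection \<open>Rotations, radial integrals and Parseval's identity\<close>

lemma nn_integral_lborel_translate:
  fixes h :: "'a::euclidean_space \<Rightarrow> ennreal"
  assumes [measurable]: "h \<in> borel_measurable borel"
  shows "(\<integral>\<^sup>+x. h (c + x) \<partial>lborel) = (\<integral>\<^sup>+x. h x \<partial>lborel)"
proof -
  have "(\<integral>\<^sup>+x. h x \<partial>lborel) = (\<integral>\<^sup>+x. h x \<partial>distr lborel borel ((+) c))"
    by (simp add: lborel_distr_plus)
  also have "\<dots> = (\<integral>\<^sup>+x. h (c + x) \<partial>lborel)"
    by (subst nn_integral_distr) auto
  finally show ?thesis ..
qed

text \<open>Both sides, times the area of the unit disc \<open>V\<close>, are evaluations by Fubini of the double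
  integral of \<open>h (c x) 1_V (y)\<close>; only translation invariance and \<open>c V = V\<close> enter.\<close>
lemma nn_integral_lborel_rotate:
  fixes c :: complex
  assumes c: "norm c = 1" and [measurable]: "h \<in> borel_measurable borel"
  shows "(\<integral>\<^sup>+x. h (c * x) \<partial>lborel) = (\<integral>\<^sup>+x. h x \<partial>lborel)"
proof -
  define g where "g = (indicator (ball 0 1) :: complex \<Rightarrow> ennreal)"
  have [measurable]: "g \<in> borel_measurable borel"
    unfolding g_def by (intro borel_measurable_indicator) simp
  have [simp]: "g (- (c * x)) = g x" "g (- (x * c)) = g x" for x
    by (simp_all add: g_def indicator_def norm_mult c)
  have c0: "c \<noteq> 0" using c by auto
  have "(\<integral>\<^sup>+x. h (c * x) \<partial>lborel) * (\<integral>\<^sup>+y. g y \<partial>lborel) = (\<integral>\<^sup>+x. \<integral>\<^sup>+y. h (c * x) * g y \<partial>lborel \<partial>lborel)"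
    by (simp add: nn_integral_cmult nn_integral_multc)
  also have "\<dots> = (\<integral>\<^sup>+x. \<integral>\<^sup>+y. h (c * x) * g (- (c * x) + y) \<partial>lborel \<partial>lborel)"
    by (intro nn_integral_cong nn_integral_lborel_translate[symmetric]) measurable
  also have "\<dots> = (\<integral>\<^sup>+y. \<integral>\<^sup>+x. h (c * x) * g (- (c * x) + y) \<partial>lborel \<partial>lborel)"
    by (rule lborel_pair.Fubini') measurable
  \<comment> \<open>As \<open>c * (y / c + x) = y + c * x\<close>, the \<open>y\<close> cancels
    inside \<open>g\<close>, and \<open>g (- (c * x)) = g x\<close> because \<open>c\<close> has
    modulus 1.\<close>
  also have "\<dots> = (\<integral>\<^sup>+y. \<integral>\<^sup>+x. h (c * (y / c + x)) * g (- (c * (y / c + x)) + y) \<partial>lborel \<partial>lborel)"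
    by (intro nn_integral_cong nn_integral_lborel_translate[symmetric]) measurable
  also have "\<dots> = (\<integral>\<^sup>+y. \<integral>\<^sup>+x. h (c * x + y) * g x \<partial>lborel \<partial>lborel)"
    using c0 by (simp add: algebra_simps)
  also have "\<dots> = (\<integral>\<^sup>+x. \<integral>\<^sup>+y. h (c * x + y) * g x \<partial>lborel \<partial>lborel)"
    by (rule lborel_pair.Fubini'[symmetric]) measurable
  also have "\<dots> = (\<integral>\<^sup>+x. (\<integral>\<^sup>+y. h (c * x + y) \<partial>lborel) * g x \<partial>lborel)"
    by (simp add: nn_integral_multc)
  also have "\<dots> = (\<integral>\<^sup>+x. (\<integral>\<^sup>+y. h y \<partial>lborel) * g x \<partial>lborel)"
    by (simp add: nn_integral_lborel_translate)
  also have "\<dots> = (\<integral>\<^sup>+y. h y \<partial>lborel) * (\<integral>\<^sup>+y. g y \<partial>lborel)"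
    by (simp add: nn_integral_cmult)
  finally have eq: "(\<integral>\<^sup>+x. h (c * x) \<partial>lborel) * (\<integral>\<^sup>+y. g y \<partial>lborel) =
      (\<integral>\<^sup>+y. h y \<partial>lborel) * (\<integral>\<^sup>+y. g y \<partial>lborel)" .
  \<comment> \<open>The area of the disc is finite and nonzero, so it can be cancelled in
    \<open>ennreal\<close>.\<close>
  have "(\<integral>\<^sup>+y. g y \<partial>lborel) = ennreal pi"
    by (simp add: g_def emeasure_ball unit_ball_vol_2)
  moreover have "x * ennreal pi * ennreal (1 / pi) = x" for x
    by (simp add: mult.assoc ennreal_mult'[symmetric])
  ultimately show ?thesis using eq by metis
qed

text \<open>Polar coordinates in the form of the law of \<open>norm\<close> under area measure.
  Measures with finite tails are determined by their values on \<open>{x<..}\<close>, and for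
  \<open>x < 1\<close> this value is the area \<open>pi (1 - m^2)\<close> of an annulus with inner
  radius \<open>m = max 0 x\<close>.\<close>

lemma distr_norm_disc:
  "distr (density lborel (indicator (ball 0 1 :: complex set))) borel norm =
   density lborel (\<lambda>r. indicator {0..1} r * ennreal (2 * pi * r))" (is "?M = ?N")
proof (rule measure_eqI_lessThan)
  fix x :: real
  define m where "m = max 0 x"
  have N: "emeasure ?N {x<..} = (if x < 1 then ennreal (pi * (1 - m\<^sup>2)) else 0)"
  proof -
    have "emeasure ?N {x<..} = (\<integral>\<^sup>+r. indicator {0..1} r * ennreal (2 * pi * r) * indicator {x<..} r \<partial>lborel)"
      by (subst emeasure_density) auto
    also have "\<dots> = (if x < 1 then ennreal (pi * (1 - m\<^sup>2)) else 0)"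
    proof (cases "x < 1")
      case True
      \<comment> \<open>The two integrands can differ only at \<open>r = x\<close>, a null
        set.\<close>
      have "(\<integral>\<^sup>+r. indicator {0..1} r * ennreal (2 * pi * r) * indicator {x<..} r \<partial>lborel) =
         (\<integral>\<^sup>+r. ennreal (2 * pi * r) * indicator {m..1} r \<partial>lborel)"
        using AE_lborel_singleton[of x]
        by (intro nn_integral_cong_AE, elim AE_mp) (auto simp: m_def indicator_def)
      also have "\<dots> = ennreal (pi * 1\<^sup>2 - pi * m\<^sup>2)"
        using True by (intro nn_integral_FTC_Icc)
          (auto simp: m_def intro!: derivative_eq_intros)
      finally show ?thesis using True by (simp add: algebra_simps)
    next
      case False
      then have "(\<integral>\<^sup>+r. indicator {0..1} r * ennreal (2 * pi * r) * indicator {x<..} r \<partial>lborel) =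
         (\<integral>\<^sup>+(r::real). 0 \<partial>lborel)"
        by (intro nn_integral_cong) (auto simp: indicator_def)
      then show ?thesis using False by simp
    qed
    finally show ?thesis .
  qed
  have M: "emeasure ?M {x<..} = (if x < 1 then ennreal (pi * (1 - m\<^sup>2)) else 0)"
  proof -
    have "emeasure ?M {x<..} = emeasure (density lborel (indicator (ball 0 1 :: complex set))) (norm -` {x<..})"
      by (subst emeasure_distr) auto
    also have "\<dots> = (\<integral>\<^sup>+w. indicator (ball 0 1 :: complex set) w * indicator (norm -` {x<..}) w \<partial>lborel)"
    proof (subst emeasure_density)
      show "norm -` {x<..} \<in> sets (lborel :: complex measure)"
        using measurable_sets[of "norm :: complex \<Rightarrow> real" borel borel "{x<..}"] by simp
    qed (auto intro!: borel_measurable_indicator)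
    also have "\<dots> = (if x < 1 then ennreal (pi * (1 - m\<^sup>2)) else 0)"
    proof (cases "x < 1")
      case True
      \<comment> \<open>For \<open>x < 0\<close> the tail is the whole disc, whereas
        \<open>cball 0 m\<close> would be the origin; hence the conditional.\<close>
      have "(\<integral>\<^sup>+w. indicator (ball 0 1 :: complex set) w * indicator (norm -` {x<..}) w \<partial>lborel) =
        (\<integral>\<^sup>+w. indicator (ball 0 1 - (if x < 0 then {} else cball 0 m) :: complex set) w \<partial>lborel)"
        by (intro nn_integral_cong) (auto simp: indicator_def m_def max_def split: if_splits
              intro: less_le_trans dest: order.trans[OF norm_ge_zero])
      also have "\<dots> = emeasure lborel (ball 0 1 - (if x < 0 then {} else cball 0 m) :: complex set)"
        by simp
      also have "\<dots> = ennreal (pi * (1 - m\<^sup>2))"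
      proof (cases "x < 0")
        case False
        have "emeasure lborel (ball 0 1 - cball 0 m :: complex set) = 
           emeasure lborel (ball 0 1 :: complex set) - emeasure lborel (cball 0 m :: complex set)"
          using True by (intro emeasure_Diff) (auto simp: emeasure_cball m_def)
        also have "\<dots> = ennreal (pi * (1 - m\<^sup>2))"
          using True by (simp add: emeasure_cball emeasure_ball m_def unit_ball_vol_2 ennreal_minus algebra_simps)
        finally show ?thesis using False by simp
      qed (simp add: emeasure_ball unit_ball_vol_2 m_def)
      finally show ?thesis using True by simp
    next
      case False
      then have "(\<integral>\<^sup>+w. indicator (ball 0 1 :: complex set) w * indicator (norm -` {x<..}) w \<partial>lborel) =
         (\<integral>\<^sup>+(w::complex). 0 \<partial>lborel)"
        by (intro nn_integral_cong) (auto simp: indicator_def)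
      then show ?thesis using False by simp
    qed
    finally show ?thesis .
  qed
  show "emeasure ?M {x<..} = emeasure ?N {x<..}" unfolding M N ..
  show "emeasure ?M {x<..} < \<infinity>" unfolding M by simp
qed auto

lemma nn_integral_radial_disc:
  assumes [measurable]: "h \<in> borel_measurable borel"
  shows "(\<integral>\<^sup>+w\<in>ball (0::complex) 1. h (norm w) \<partial>lborel) = (\<integral>\<^sup>+r\<in>{0..1}. ennreal (2 * pi * r) * h r \<partial>lborel)"
proof -
  have "(\<integral>\<^sup>+w\<in>ball (0::complex) 1. h (norm w) \<partial>lborel) =
      (\<integral>\<^sup>+w. h (norm w) \<partial>density lborel (indicator (ball 0 1 :: complex set)))"
    by (subst nn_integral_density) (auto simp: mult.commute intro!: borel_measurable_indicator)
  also have "\<dots> = (\<integral>\<^sup>+r. h r \<partial>distr (density lborel (indicator (ball 0 1 :: complex set))) borel norm)"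
    by (subst nn_integral_distr) auto
  also have "\<dots> = (\<integral>\<^sup>+r\<in>{0..1}. ennreal (2 * pi * r) * h r \<partial>lborel)"
    unfolding distr_norm_disc by (subst nn_integral_density) (auto simp: mult_ac)
  finally show ?thesis .
qed

lemma has_integral_cis_power:
  "((\<lambda>t. cis t ^ m * cnj (cis t ^ n)) has_integral (if m = n then 2 * pi else 0)) {0..2 * pi}"
proof (cases "m = n")
  case True
  have "(\<lambda>t. cis t ^ m * cnj (cis t ^ n)) = (\<lambda>t. 1)"
    by (simp add: True fun_eq_iff power_mult_distrib[symmetric] cis_cnj cis_mult)
  then show ?thesis using has_integral_const_real[of "1::complex" 0 "2*pi"] True
    by (simp add: scaleR_conv_of_real)
next
  case False
  define a where "a = \<i> * (of_nat m - of_nat n :: complex)"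
  have a: "a \<noteq> 0" using False by (simp add: a_def)
  have e: "cis t ^ m * cnj (cis t ^ n) = exp (a * of_real t)" for t
    unfolding complex_cnj_power cis_cnj Complex.DeMoivre cis_mult by (simp add: cis_conv_exp a_def algebra_simps)
  have "((\<lambda>t. exp (a * of_real t) / a) has_vector_derivative exp (a * of_real t)) (at t within {0..2*pi})" for t
    by (rule has_vector_derivative_real_field)
       (use a in \<open>auto intro!: derivative_eq_intros\<close>)
  then have "((\<lambda>t. exp (a * of_real t)) has_integral (exp (a * of_real (2*pi)) / a - exp (a * of_real 0) / a)) {0..2*pi}"
    by (intro fundamental_theorem_of_calculus) auto
  moreover have "exp (a * of_real (2*pi)) = 1"
  proof -
    have "exp (a * of_real (2 * pi)) = exp (complex_of_real (2 * of_int (int m - int n) * pi) * \<i>)"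
      by (rule arg_cong[where f = exp]) (simp add: a_def)
    also have "\<dots> = 1" by (rule exp_integer_2pi) (rule Ints_of_int)
    finally show ?thesis .
  qed
  ultimately show ?thesis using False by (simp add: e[symmetric])
qed

lemma summable_norm_square:
  fixes d :: "nat \<Rightarrow> 'a::real_normed_vector"
  assumes d: "summable (\<lambda>m. norm (d m))"
  shows "summable (\<lambda>m. (norm (d m))\<^sup>2)"
proof (rule summable_comparison_test_ev[OF _ d])
  from summable_LIMSEQ_zero[OF d] have "eventually (\<lambda>m. norm (d m) < 1) sequentially"
    by (rule order_tendstoD) simp
  then show "eventually (\<lambda>m. norm ((norm (d m))\<^sup>2) \<le> norm (d m)) sequentially"
    by eventually_elim (simp add: power2_eq_square mult_left_le)
qed

text \<open>Orthogonality of the powers of \<open>cis t\<close> settles the partial sums. Absolute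
  summability bounds all of them by one constant \<open>B\<close>, so dominated convergence with
  majorant \<open>B^2\<close> passes to the limit.\<close>

lemma circle_Parseval:
  fixes d :: "nat \<Rightarrow> complex"
  assumes d: "summable (\<lambda>m. norm (d m))"
  shows "((\<lambda>t. (norm (\<Sum>m. d m * cis t ^ m))\<^sup>2) has_integral 2 * pi * (\<Sum>m. (norm (d m))\<^sup>2)) {0..2 * pi}"
proof -
  define S where "S N t = (\<Sum>m<N. d m * cis t ^ m)" for N t
  have fin: "((\<lambda>t. (norm (S N t))\<^sup>2) has_integral 2 * pi * (\<Sum>m<N. (norm (d m))\<^sup>2)) {0..2*pi}" for N
  proof -
    have "((\<lambda>t. \<Sum>m<N. \<Sum>n<N. d m * cnj (d n) * (cis t ^ m * cnj (cis t ^ n))) has_integral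
       (\<Sum>m<N. \<Sum>n<N. d m * cnj (d n) * (if m = n then 2 * pi else 0))) {0..2*pi}"
      by (intro has_integral_sum has_integral_mult_right has_integral_cis_power) auto
    moreover have "(\<Sum>m<N. \<Sum>n<N. d m * cnj (d n) * (cis t ^ m * cnj (cis t ^ n))) = of_real ((norm (S N t))\<^sup>2)" for t
      unfolding complex_norm_square S_def cnj_sum sum_product
      by (intro sum.cong refl) simp
    moreover have "(\<Sum>m<N. \<Sum>n<N. d m * cnj (d n) * (if m = n then 2 * pi else 0)) = 
        of_real (2 * pi * (\<Sum>m<N. (norm (d m))\<^sup>2))"
    proof -
      have "(\<Sum>n<N. d m * cnj (d n) * (if m = n then 2 * pi else 0)) = of_real (2 * pi * (norm (d m))\<^sup>2)"
        if "m < N" for m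
      proof -
        have "(\<Sum>n<N. d m * cnj (d n) * (if m = n then 2 * pi else 0)) = 
          (\<Sum>n<N. if m = n then d m * cnj (d m) * (2 * pi) else 0)" by (intro sum.cong) auto
        also have "\<dots> = of_real ((norm (d m))\<^sup>2) * (2 * pi)"
          using that complex_norm_square[of "d m"] by simp
        finally show ?thesis by simp
      qed
      then show ?thesis by (simp add: sum_distrib_left)
    qed
    ultimately have "((\<lambda>t. complex_of_real ((norm (S N t))\<^sup>2)) has_integral of_real (2 * pi * (\<Sum>m<N. (norm (d m))\<^sup>2))) {0..2*pi}"
      by simp
    from has_integral_linear[OF this bounded_linear_Re] show ?thesis by (simp add: o_def)
  qed
  define B where "B = (\<Sum>m. norm (d m))"
  have sm: "summable (\<lambda>m. norm (d m * cis t ^ m))" for t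
    using d by (simp add: norm_mult norm_power)
  have lim: "(\<lambda>N. S N t) \<longlonglongrightarrow> (\<Sum>m. d m * cis t ^ m)" for t
    unfolding S_def by (intro summable_LIMSEQ summable_norm_cancel[OF sm])
  have bd: "norm ((norm (S N t))\<^sup>2) \<le> B\<^sup>2" for N t
  proof -
    have "norm (S N t) \<le> (\<Sum>m<N. norm (d m * cis t ^ m))" unfolding S_def by (rule norm_sum)
    also have "\<dots> = (\<Sum>m<N. norm (d m))" by (simp add: norm_mult norm_power)
    also have "\<dots> \<le> B" unfolding B_def by (intro sum_le_suminf d) auto
    finally show ?thesis by (simp add: power_mono)
  qed
  have dom: "(\<lambda>t. (norm (\<Sum>m. d m * cis t ^ m))\<^sup>2) integrable_on {0..2*pi}"
     "(\<lambda>N. integral {0..2*pi} (\<lambda>t. (norm (S N t))\<^sup>2)) \<longlonglongrightarrow> integral {0..2*pi} (\<lambda>t. (norm (\<Sum>m. d m * cis t ^ m))\<^sup>2)"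
    by (rule dominated_convergence[where h = "\<lambda>_. B\<^sup>2" and f = "\<lambda>N t. (norm (S N t))\<^sup>2"];
        use fin bd lim in \<open>auto intro!: tendsto_intros simp: integrable_on_def\<close>)+
  note sq = summable_norm_square[OF d]
  have "(\<lambda>N. integral {0..2*pi} (\<lambda>t. (norm (S N t))\<^sup>2)) \<longlonglongrightarrow> 2 * pi * (\<Sum>m. (norm (d m))\<^sup>2)"
    using tendsto_mult_left[OF summable_LIMSEQ[OF sq], of "2 * pi"] integral_unique[OF fin] by simp
  from LIMSEQ_unique[OF this dom(2)] dom(1) show ?thesis
    by (simp add: has_integral_iff)
qed

subsection \<open>Taylor coefficients of the pullback\<close>

lemma powser_summable_norm:
  fixes c :: "nat \<Rightarrow> complex"
  assumes "\<And>z. norm z < 1 \<Longrightarrow> summable (\<lambda>m. c m * z ^ m)" "norm w < 1"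
  shows "summable (\<lambda>m. norm (c m * w ^ m))"
proof -
  obtain r where "norm w < r" "r < 1" using assms(2) dense by blast
  moreover from this have "0 < r" using norm_ge_zero le_less_trans by blast
  ultimately show ?thesis
    using powser_insidea[OF assms(1), of "of_real r" w] by simp
qed

text \<open>Division by \<open>fact i\<close> turns falling factorials into binomials, the shape in
  which \<open>disc_term\<close> uses them. The induction passes to \<open>deriv F\<close> with
  coefficients \<open>diffs c\<close>, so \<open>c\<close> and \<open>F\<close> must vary in
  it.\<close>

lemma higher_deriv_sums:
  fixes c :: "nat \<Rightarrow> complex"
  assumes "\<And>z. norm z < 1 \<Longrightarrow> (\<lambda>m. c m * z ^ m) sums F z" "norm w < 1"
  shows "(\<lambda>m. of_nat (m choose i) * c m * w ^ (m - i)) sums ((deriv ^^ i) F w / fact i)"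
    and "summable (\<lambda>m. norm (of_nat (m choose i) * c m * w ^ (m - i)))"
proof -
  have "(\<lambda>m. of_nat (m choose i) * c m * w ^ (m - i)) sums ((deriv ^^ i) F w / fact i) \<and>
     summable (\<lambda>m. norm (of_nat (m choose i) * c m * w ^ (m - i)))"
    using assms
  proof (induction i arbitrary: c F)
    case 0
    then show ?case using powser_summable_norm[of c w] by (auto simp: sums_iff)
  next
    case (Suc i)
    define c' where "c' = diffs c"
    have F: "(\<lambda>m. c' m * z ^ m) sums deriv F z" if z: "norm z < 1" for z
    proof -
      have "F holomorphic_on ball 0 1"
        using Suc.prems(1) by (intro power_series_holomorphic[where a = c]) auto
      then have "(F has_field_derivative deriv F z) (at z)"
        using z by (intro holomorphic_derivI[of F "ball 0 1"]) auto
      from termdiffs_sums_strong[OF Suc.prems(1) this z] show ?thesis unfolding c'_def .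
    qed
    let ?t = "\<lambda>m. of_nat (m choose (Suc i)) * c m * w ^ (m - Suc i)"
    have eq: "?t (Suc m) = (of_nat (m choose i) * c' m * w ^ (m - i)) / of_nat (Suc i)" for m
    proof -
      have "of_nat (Suc i) * of_nat (Suc m choose Suc i) = (of_nat (Suc m) * of_nat (m choose i) :: complex)"
        unfolding of_nat_mult[symmetric] Suc_times_binomial ..
      then have "(of_nat (Suc m choose Suc i) :: complex) = of_nat (Suc m) * of_nat (m choose i) / of_nat (Suc i)"
        using nonzero_mult_div_cancel_left[of "of_nat (Suc i) :: complex" "of_nat (Suc m choose Suc i)"]
        by (simp only: of_nat_eq_0_iff)
      then show ?thesis unfolding c'_def diffs_def
        by (simp only: diff_Suc_Suc times_divide_eq_left times_divide_eq_right mult_ac)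
    qed
    note IH = Suc.IH[OF F Suc.prems(2)]
    have "(\<lambda>m. ?t (Suc m)) sums ((deriv ^^ i) (deriv F) w / fact i / of_nat (Suc i))"
      unfolding eq by (intro sums_divide conjunct1[OF IH])
    \<comment> \<open>The summand \<open>?t 0\<close> is 0, because
      \<open>0 choose Suc i = 0\<close>.\<close>
    then have "?t sums ((deriv ^^ i) (deriv F) w / fact i / of_nat (Suc i) + ?t 0)"
      by (rule iffD1[OF sums_Suc_iff[of ?t]])
    moreover have "(deriv ^^ i) (deriv F) w / fact i / of_nat (Suc i) + ?t 0 = (deriv ^^ Suc i) F w / fact (Suc i)"
      by (simp add: funpow_swap1 mult.commute del: of_nat_Suc)
    ultimately have 1: "?t sums ((deriv ^^ Suc i) F w / fact (Suc i))" by (simp only:)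
    have "summable (\<lambda>m. norm (?t (Suc m)))"
      unfolding eq norm_divide by (intro summable_divide conjunct2[OF IH])
    then have "summable (\<lambda>m. norm (?t m))"
      by (subst (asm) summable_Suc_iff)
    with 1 show ?case by simp
  qed
  then show "(\<lambda>m. of_nat (m choose i) * c m * w ^ (m - i)) sums ((deriv ^^ i) F w / fact i)"
    "summable (\<lambda>m. norm (of_nat (m choose i) * c m * w ^ (m - i)))" by auto
qed

text \<open>The negative binomial series, verified by multiplication: multiplying by
  \<open>1 + a X\<close> lowers \<open>n\<close> by one, which on coefficients is Pascal's rule, and
  the case \<open>n = 0\<close> is the geometric series.\<close>

lemma fps_nth_inverse_linear_power:
  fixes a :: complex
  shows "inverse (1 + fps_const a * fps_X) ^ Suc n = Abs_fps (\<lambda>k. of_nat ((n + k) choose k) * (- a) ^ k)"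
proof -
  let ?L = "1 + fps_const a * fps_X :: complex fps"
  have L: "inverse ?L * ?L = 1" by (rule inverse_mult_eq_1) simp
  have nth_mult: "fps_nth (A * ?L) 0 = fps_nth A 0"
    "fps_nth (A * ?L) (Suc j) = fps_nth A (Suc j) + a * fps_nth A j" for A j
  proof -
    have eq: "A * ?L = A + fps_const a * (A * fps_X)" by (simp only: distrib_left mult_1_right mult_ac)
    show "fps_nth (A * ?L) 0 = fps_nth A 0"
      "fps_nth (A * ?L) (Suc j) = fps_nth A (Suc j) + a * fps_nth A j"
      unfolding eq by simp_all
  qed
  have alg: "(x + y) * (- a * p) + a * (x * p) = y * (- a * p)" for x y p
    by (simp add: algebra_simps)
  have step: "Abs_fps (\<lambda>k. of_nat ((Suc n + k) choose k) * (- a) ^ k) * ?L =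
      Abs_fps (\<lambda>k. of_nat ((n + k) choose k) * (- a) ^ k)" for n
  proof (rule fps_ext)
    fix k
    show "fps_nth (Abs_fps (\<lambda>k. of_nat ((Suc n + k) choose k) * (- a) ^ k) * ?L) k =
       fps_nth (Abs_fps (\<lambda>k. of_nat ((n + k) choose k) * (- a) ^ k)) k"
    proof (cases k)
      case (Suc j)
      have "(Suc n + Suc j) choose Suc j = ((Suc n + j) choose j) + ((n + Suc j) choose Suc j)"
        using binomial_Suc_Suc[of "n + Suc j" j] by (simp only: add_Suc_right add_Suc)
      then have e: "(of_nat ((Suc n + Suc j) choose Suc j) :: complex) =
          of_nat ((Suc n + j) choose j) + of_nat ((n + Suc j) choose Suc j)"
        by (simp only: of_nat_add)
      show ?thesis unfolding Suc nth_mult fps_nth_Abs_fps e power_Suc by (rule alg)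
    qed (simp only: nth_mult fps_nth_Abs_fps, simp)
  qed
  have base: "Abs_fps (\<lambda>k. of_nat ((0 + k) choose k) * (- a) ^ k) * ?L = 1"
  proof (rule fps_ext)
    fix k
    show "fps_nth (Abs_fps (\<lambda>k. of_nat ((0 + k) choose k) * (- a) ^ k) * ?L) k = fps_nth 1 k"
    proof (cases k)
      case (Suc j)
      show ?thesis unfolding Suc nth_mult fps_nth_Abs_fps by simp
    qed (simp only: nth_mult fps_nth_Abs_fps, simp)
  qed
  have cancel: "A = B * inverse ?L" if "A * ?L = B" for A B
  proof -
    have "A = A * (inverse ?L * ?L)" unfolding L by simp
    also have "\<dots> = B * inverse ?L" unfolding that[symmetric] by (simp only: mult_ac)
    finally show ?thesis .
  qed
  show ?thesis
  proof (induction n)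
    case 0
    show ?case unfolding cancel[OF base] by (simp only: power_one_right mult_1_left power_Suc power_0 mult_1_right)
  next
    case (Suc n)
    show ?case unfolding power_Suc2[of _ "Suc n"] Suc.IH by (rule cancel[OF step[of n], symmetric])
  qed
qed

text \<open>The value \<open>w\<close> at \<open>z = 0\<close> is split off, so that the rest has a
  power series without constant term and can be substituted into the expansion of \<open>Q\<close>
  at \<open>w\<close>.\<close>

lemma disc_aut_expand:
  assumes "1 + cnj w * z \<noteq> 0"
  shows "disc_aut w z = w + z * of_real (1 - (norm w)\<^sup>2) * inverse (1 + cnj w * z)"
proof -
  have "z + w = w * (1 + cnj w * z) + z * (1 - w * cnj w)" by (simp add: algebra_simps)
  then show ?thesis using assms
    by (simp add: disc_aut_def divide_simps complex_norm_square[unfolded of_real_power])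
qed

lemma deriv_disc_aut:
  assumes "1 + cnj w * z \<noteq> 0"
  shows "deriv (disc_aut w) z = of_real (1 - (norm w)\<^sup>2) * inverse (1 + cnj w * z) ^ 2"
proof (rule DERIV_imp_deriv)
  have "(disc_aut w has_field_derivative
      (1 * (1 + cnj w * z) - (z + w) * cnj w) / ((1 + cnj w * z) * (1 + cnj w * z))) (at z)"
    unfolding disc_aut_def[abs_def] using assms by (auto intro!: derivative_eq_intros)
  moreover have "1 * (1 + cnj w * z) - (z + w) * cnj w = of_real (1 - (norm w)\<^sup>2)"
    by (simp add: complex_norm_square[unfolded of_real_power] algebra_simps)
  ultimately show "(disc_aut w has_field_derivative of_real (1 - (norm w)\<^sup>2) * inverse (1 + cnj w * z) ^ 2) (at z)"
    by (simp only:) (simp add: power2_eq_square divide_inverse)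
qed

lemma has_fps_expansion_quad_pullback:
  assumes Q: "Q holomorphic_on unit_disc" and w: "w \<in> unit_disc"
  defines "H \<equiv> inverse (1 + fps_const (cnj w) * fps_X)"
  defines "s \<equiv> complex_of_real (1 - (norm w)\<^sup>2)"
  shows "quad_pullback Q w has_fps_expansion
    fps_compose (fps_expansion Q w) (fps_X * fps_const s * H) * (fps_const s * H ^ 2) ^ 2"
proof -
  have an: "Q analytic_on {w}" using Q w by (meson analytic_at open_ball)
  have H: "(\<lambda>z. inverse (1 + cnj w * z)) has_fps_expansion H"
    unfolding H_def by (intro fps_expansion_intros) auto
  have G: "(\<lambda>z. z * s * inverse (1 + cnj w * z)) has_fps_expansion (fps_X * fps_const s * H)"
    by (intro fps_expansion_intros H)
  have QG: "((\<lambda>x. Q (w + x)) \<circ> (\<lambda>z. z * s * inverse (1 + cnj w * z))) has_fps_expansion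
      fps_compose (fps_expansion Q w) (fps_X * fps_const s * H)"
    by (rule has_fps_expansion_compose[OF analytic_at_imp_has_fps_expansion[OF an] G]) simp
  have K: "(\<lambda>z. (s * inverse (1 + cnj w * z) ^ 2) ^ 2) has_fps_expansion (fps_const s * H ^ 2) ^ 2"
    by (intro has_fps_expansion_power has_fps_expansion_mult has_fps_expansion_const H)
  note 1 = has_fps_expansion_mult[OF QG K]
  have "eventually (\<lambda>z. z \<in> unit_disc) (nhds (0::complex))"
    by (intro eventually_nhds_in_open) auto
  then have "eventually (\<lambda>z. ((\<lambda>x. Q (w + x)) \<circ> (\<lambda>z. z * s * inverse (1 + cnj w * z))) z * (s * inverse (1 + cnj w * z) ^ 2) ^ 2
     = quad_pullback Q w z) (nhds 0)"
  proof eventually_elim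
    case (elim z)
    have "norm w * norm z \<le> norm z" using w by (intro mult_left_le_one_le) auto
    then have "norm (cnj w * z) < 1" using elim by (simp add: norm_mult)
    then have "1 + cnj w * z \<noteq> 0" by (auto simp: add_eq_0_iff)
    then show ?case by (simp add: quad_pullback_def deriv_disc_aut disc_aut_expand s_def)
  qed
  from has_fps_expansion_cong[OF this refl] 1 show ?thesis by (rule iffD1)
qed

text \<open>With \<open>G\<close> the series of \<open>disc_aut w z - w\<close> and \<open>K\<close>
  that of the squared derivative, \<open>G^i K = X^i s^(i+2) H^(i+4)\<close>, since \<open>K\<close>
  contributes \<open>s^2 H^4\<close>. As \<open>G^i\<close> starts at \<open>X^i\<close>, only
  \<open>i \<le> k\<close> reach the coefficient of \<open>X^k\<close>, and the coefficient of
  \<open>X^(k-i)\<close> in \<open>H^(i+4)\<close> supplies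
  \<open>(k + 3) choose (i + 3)\<close>.\<close>

lemma pullback_coeff_eq:
  assumes Q: "Q holomorphic_on unit_disc" and w: "w \<in> unit_disc" and aw: "pullback_coeffs Q aw"
  shows "(of_nat (k + 2) ^ 3 - of_nat (k + 2)) * aw w (k + 2) =
    (\<Sum>i\<le>k. (deriv ^^ i) Q w / fact i * of_nat ((k + 3) choose (i + 3)) * (-1) ^ (k - i)
        * of_real (1 - (norm w)\<^sup>2) ^ (i + 2) * cnj w ^ (k - i))"
proof -
  define H where "H = inverse (1 + fps_const (cnj w) * fps_X)"
  define s where "s = complex_of_real (1 - (norm w)\<^sup>2)"
  define F where "F = fps_expansion Q w"
  define P where "P = Abs_fps (\<lambda>m. (of_nat (m + 2) ^ 3 - of_nat (m + 2)) * aw w (m + 2))"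
  have "quad_pullback Q w has_fps_expansion P"
  proof (rule has_fps_expansionI)
    have "eventually (\<lambda>z. z \<in> unit_disc) (nhds (0::complex))"
      by (intro eventually_nhds_in_open) auto
    then show "eventually (\<lambda>z. (\<lambda>n. fps_nth P n * z ^ n) sums quad_pullback Q w z) (nhds 0)"
      by eventually_elim (use aw w in \<open>simp add: P_def pullback_coeffs_def\<close>)
  qed
  from fps_expansion_unique_complex[OF this has_fps_expansion_quad_pullback[OF Q w]]
  have P: "P = fps_compose F (fps_X * fps_const s * H) * (fps_const s * H ^ 2) ^ 2"
    by (simp add: F_def H_def s_def)
  define G where "G = fps_X * fps_const s * H"
  define K where "K = (fps_const s * H ^ 2) ^ 2"
  have GK: "G ^ i * K = fps_X ^ i * (fps_const (s ^ (i + 2)) * H ^ Suc (i + 3))" for i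
  proof -
    have "(x * c * h) ^ i * (c * h ^ 2) ^ 2 = x ^ i * (c ^ (i + 2) * h ^ Suc (i + 3))" for x c h :: "complex fps"
    proof -
      have "(c * h ^ 2) ^ 2 = c ^ 2 * h ^ 4" by (simp add: power_mult_distrib)
      moreover have "Suc (i + 3) = i + 4" by simp
      ultimately show ?thesis by (simp only: power_mult_distrib power_add mult_ac)
    qed
    from this[of fps_X "fps_const s" H] show ?thesis
      unfolding G_def K_def fps_const_power[symmetric] .
  qed
  have Gn: "fps_nth (G ^ i) n = 0" if "n < i" for i n
    unfolding G_def power_mult_distrib mult.assoc using that by (simp add: fps_X_power_mult_nth)
  \<comment> \<open>The range is enlarged from \<open>n\<close> to the common bound
    \<open>k\<close>, so that the sums over \<open>i\<close> and \<open>n\<close> can be swapped and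
    the convolution with \<open>K\<close> carried out for each \<open>i\<close>.\<close>
  have FG: "fps_nth (fps_compose F G) n = (\<Sum>i\<le>k. fps_nth F i * fps_nth (G ^ i) n)" if "n \<le> k" for n
    unfolding fps_compose_nth atLeast0AtMost
    by (rule sum.mono_neutral_left) (use that in \<open>simp_all add: Gn\<close>)
  have "fps_nth P k = (\<Sum>n\<le>k. fps_nth (fps_compose F G) n * fps_nth K (k - n))"
    unfolding P G_def[symmetric] K_def[symmetric] fps_mult_nth atLeast0AtMost ..
  also have "\<dots> = (\<Sum>n\<le>k. (\<Sum>i\<le>k. fps_nth F i * fps_nth (G ^ i) n) * fps_nth K (k - n))"
    by (rule sum.cong) (simp_all only: FG atMost_iff)
  also have "\<dots> = (\<Sum>i\<le>k. fps_nth F i * fps_nth (G ^ i * K) k)"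
    unfolding fps_mult_nth sum_distrib_left sum_distrib_right atLeast0AtMost
    by (subst sum.swap) (simp add: mult.assoc)
  also have "\<dots> = (\<Sum>i\<le>k. (deriv ^^ i) Q w / fact i * of_nat ((k + 3) choose (i + 3)) * (-1) ^ (k - i)
        * s ^ (i + 2) * cnj w ^ (k - i))"
  proof (intro sum.cong refl)
    fix i assume i: "i \<in> {..k}"
    have "(i + 3 + (k - i)) choose (k - i) = (k + 3) choose (i + 3)"
      using i binomial_symmetric[of "i + 3" "k + 3"] by (simp add: add.commute)
    then have "fps_nth (G ^ i * K) k = s ^ (i + 2) * (of_nat ((k + 3) choose (i + 3)) * (- cnj w) ^ (k - i))"
      unfolding GK fps_X_power_mult_nth H_def fps_nth_inverse_linear_power using i by simp
    moreover have "fps_nth F i = (deriv ^^ i) Q w / fact i" by (simp add: F_def fps_expansion_def)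
    ultimately show "fps_nth F i * fps_nth (G ^ i * K) k = 
      (deriv ^^ i) Q w / fact i * of_nat ((k + 3) choose (i + 3)) * (-1) ^ (k - i) * s ^ (i + 2) * cnj w ^ (k - i)"
      by (simp add: power_minus[of "cnj w"] mult_ac)
  qed
  finally show ?thesis by (simp add: P_def s_def)
qed

subsection \<open>Integration over the disc\<close>

text \<open>This is \<open>D_km\<close>: the coefficient of \<open>z ^ k\<close> in the pullback of
  \<open>z ^ m\<close>, with one factor \<open>1 - |w|^2\<close> divided out. Hence the exponent
  \<open>i + 1\<close> where the pullback has \<open>i + 2\<close>.\<close>

definition disc_term :: "nat \<Rightarrow> nat \<Rightarrow> complex \<Rightarrow> complex" where
  "disc_term k m w = (\<Sum>i\<le>k. of_nat (m choose i) * of_nat ((k + 3) choose (i + 3)) * (-1) ^ (k - i)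
      * of_real (1 - (norm w)\<^sup>2) ^ (i + 1) * w ^ (m - i) * cnj w ^ (k - i))"

text \<open>The phases \<open>m - i\<close> from \<open>w\<close> and \<open>-(k - i)\<close> from
  \<open>cnj w\<close> add up to \<open>m - k\<close> for every \<open>i \<le> m\<close>; for larger
  \<open>i\<close> the binomial vanishes. Writing the phase as two natural powers isolates the
  factor that depends on \<open>m\<close>.\<close>

lemma disc_term_rotate:
  "disc_term k m (cis t * w) = cnj (cis t) ^ k * cis t ^ m * disc_term k m w"
  unfolding disc_term_def sum_distrib_left
proof (intro sum.cong refl)
  fix i assume i: "i \<in> {..k}"
  let ?C = "of_nat (m choose i) * of_nat ((k + 3) choose (i + 3)) * (-1) ^ (k - i) :: complex"
  let ?s = "complex_of_real (1 - (norm w)\<^sup>2) ^ (i + 1)"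
  have n: "norm (cis t * w) = norm w" by (simp add: norm_mult)
  show "?C * of_real (1 - (norm (cis t * w))\<^sup>2) ^ (i + 1) * (cis t * w) ^ (m - i) * cnj (cis t * w) ^ (k - i) =
     cnj (cis t) ^ k * cis t ^ m * (?C * ?s * w ^ (m - i) * cnj w ^ (k - i))"
  proof (cases "i \<le> m")
    case True
    have "cnj (cis t) * cis t = 1" by (simp add: cis_cnj cis_mult)
    then have "cnj (cis t) ^ i * cis t ^ i = 1" by (metis power_mult_distrib power_one)
    moreover have "cnj (cis t) ^ k = cnj (cis t) ^ (k - i) * cnj (cis t) ^ i" "cis t ^ m = cis t ^ (m - i) * cis t ^ i"
      using True i by (simp_all add: power_add[symmetric])
    ultimately have "cnj (cis t) ^ k * cis t ^ m = cnj (cis t) ^ (k - i) * cis t ^ (m - i)"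
      by (metis (no_types, lifting) mult.assoc mult.commute mult_1_right)
    then show ?thesis unfolding n complex_cnj_mult power_mult_distrib by (simp only: mult_ac)
  qed (simp add: binomial_eq_0)
qed

lemma norm_disc_term: "norm (disc_term k m w) = \<bar>radial_coeff k m (norm w)\<bar>"
proof -
  have "w = cis (Arg w) * of_real (norm w)"
    using rcis_cmod_Arg[of w] by (simp add: rcis_def mult.commute)
  then have "norm (disc_term k m w) = norm (disc_term k m (cis (Arg w) * of_real (norm w)))" by simp
  also have "\<dots> = norm (disc_term k m (of_real (norm w)))"
    unfolding disc_term_rotate by (simp add: norm_mult norm_power)
  also have "disc_term k m (of_real (norm w)) = of_real (radial_coeff k m (norm w))"
    by (simp add: disc_term_def radial_coeff_def radial_term_def)
  finally show ?thesis by simp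
qed

lemma borel_measurable_disc_term [measurable]: "disc_term k m \<in> borel_measurable borel"
  unfolding disc_term_def[abs_def]
  by (intro borel_measurable_continuous_onI continuous_intros)

lemma disc_term_zero: "disc_term 0 m w = of_real (1 - (norm w)\<^sup>2) * w ^ m"
  by (simp add: disc_term_def)

text \<open>The series of each derivative of \<open>Q\<close> at \<open>w\<close> is inserted into
  the finite sum over \<open>i\<close>, and the terms with the same \<open>m\<close> are collected.
  Absolute convergence is inherited from the \<open>k + 1\<close> series involved.\<close>

lemma disc_term_sums:
  fixes c :: "nat \<Rightarrow> complex"
  assumes Q: "\<And>z. norm z < 1 \<Longrightarrow> (\<lambda>m. c m * z ^ m) sums Q z" and w: "norm w < 1"
  shows "summable (\<lambda>m. norm (c m * disc_term k m w))"
    and "pullback_coeffs Q aw \<Longrightarrow>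
      (of_nat (k + 2) ^ 3 - of_nat (k + 2)) * aw w (k + 2) = of_real (1 - (norm w)\<^sup>2) * (\<Sum>m. c m * disc_term k m w)"
proof -
  define T where "T i m = of_nat (m choose i) * c m * w ^ (m - i)" for i m
  define E where "E i = of_nat ((k + 3) choose (i + 3)) * (-1) ^ (k - i) * complex_of_real (1 - (norm w)\<^sup>2) ^ (i + 1) * cnj w ^ (k - i)" for i
  have T: "T i sums ((deriv ^^ i) Q w / fact i)" "summable (\<lambda>m. norm (T i m))" for i
    unfolding T_def using higher_deriv_sums[OF Q w] by auto
  have eq: "c m * disc_term k m w = (\<Sum>i\<le>k. E i * T i m)" for m
    unfolding disc_term_def sum_distrib_left
    by (intro sum.cong refl) (simp only: E_def T_def mult_ac)
  show "summable (\<lambda>m. norm (c m * disc_term k m w))"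
  proof (rule summable_comparison_test)
    show "\<exists>N. \<forall>m\<ge>N. norm (norm (c m * disc_term k m w)) \<le> (\<Sum>i\<le>k. norm (E i) * norm (T i m))"
      unfolding eq by (auto simp: norm_mult[symmetric] intro: norm_sum)
    show "summable (\<lambda>m. \<Sum>i\<le>k. norm (E i) * norm (T i m))"
      by (intro summable_sum summable_mult T)
  qed
  assume aw: "pullback_coeffs Q aw"
  have hol: "Q holomorphic_on unit_disc"
    using Q by (intro power_series_holomorphic[where a = c]) auto
  have "(\<lambda>m. c m * disc_term k m w) sums (\<Sum>i\<le>k. E i * ((deriv ^^ i) Q w / fact i))"
    unfolding eq by (intro sums_sum sums_mult T)
  then have S: "(\<Sum>m. c m * disc_term k m w) = (\<Sum>i\<le>k. E i * ((deriv ^^ i) Q w / fact i))"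
    by (rule sums_unique[symmetric])
  have w': "w \<in> unit_disc" using w by simp
  show "(of_nat (k + 2) ^ 3 - of_nat (k + 2)) * aw w (k + 2) = of_real (1 - (norm w)\<^sup>2) * (\<Sum>m. c m * disc_term k m w)"
    unfolding pullback_coeff_eq[OF hol w' aw] S sum_distrib_left E_def
    by (intro sum.cong refl) (simp add: mult_ac)
qed

text \<open>The phases \<open>m - k\<close> are distinct for distinct \<open>m\<close>, so the terms
  are orthogonal on each circle; the factor \<open>cnj (cis t) ^ k\<close> is common to all terms
  and has modulus 1. Rather than passing to polar coordinates, the proof integrates over the
  rotation angle as an extra variable and exchanges the order.\<close>

lemma nn_integral_disc_Parseval:
  fixes f :: "nat \<Rightarrow> complex \<Rightarrow> complex"
  assumes [measurable]: "\<And>m. f m \<in> borel_measurable borel"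
    and summ: "\<And>w. norm w < 1 \<Longrightarrow> summable (\<lambda>m. norm (f m w))"
    and rot: "\<And>m t w. f m (cis t * w) = cnj (cis t) ^ k * cis t ^ m * f m w"
  shows "(\<integral>\<^sup>+w\<in>ball 0 1. ennreal ((norm (\<Sum>m. f m w))\<^sup>2) \<partial>lborel) =
    (\<Sum>m. \<integral>\<^sup>+w\<in>ball 0 1. ennreal ((norm (f m w))\<^sup>2) \<partial>lborel)"
proof -
  \<comment> \<open>Extension by zero makes rotation invariance on the whole plane applicable and
    the series absolutely convergent everywhere.\<close>
  define g where "g m w = indicator (ball 0 1) w *\<^sub>R f m w" for m w
  have [measurable]: "(indicator (ball 0 1) :: complex \<Rightarrow> real) \<in> borel_measurable borel"
    by (intro borel_measurable_indicator) simp
  have [measurable]: "g m \<in> borel_measurable borel" for m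
    unfolding g_def[abs_def] by measurable
  have g_summ: "summable (\<lambda>m. norm (g m w))" for w
    using summ[of w] by (cases "norm w < 1") (auto simp: g_def)
  have g_rot: "g m (cis t * w) = cnj (cis t) ^ k * (g m w * cis t ^ m)" for m t w
    by (simp add: g_def rot norm_mult indicator_def)
  define G where "G w = ennreal ((norm (\<Sum>m. g m w))\<^sup>2)" for w
  have [measurable]: "G \<in> borel_measurable borel" unfolding G_def[abs_def] by measurable
  have cis_meas [measurable]: "cis \<in> borel_measurable borel"
    by (intro borel_measurable_continuous_onI continuous_intros)
  have G_eq: "G w = ennreal ((norm (\<Sum>m. f m w))\<^sup>2) * indicator (ball 0 1) w" for w
    by (cases "norm w < 1") (auto simp: G_def g_def)
  have gm_eq: "ennreal ((norm (g m w))\<^sup>2) = ennreal ((norm (f m w))\<^sup>2) * indicator (ball 0 1) w" for m w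
    by (cases "norm w < 1") (auto simp: g_def)
  have G_rot: "G (cis t * w) = ennreal ((norm (\<Sum>m. g m w * cis t ^ m))\<^sup>2)" for t w
  proof -
    have "summable (\<lambda>m. g m w * cis t ^ m)"
      by (rule summable_norm_cancel) (use g_summ in \<open>simp add: norm_mult norm_power\<close>)
    then show ?thesis
      unfolding G_def g_rot by (simp add: suminf_mult norm_mult norm_power)
  qed
  have circle: "(\<integral>\<^sup>+t\<in>{0..2*pi}. G (cis t * w) \<partial>lborel) = ennreal (2 * pi) * (\<Sum>m. ennreal ((norm (g m w))\<^sup>2))" for w
  proof -
    note P = circle_Parseval[OF g_summ[of w]]
    have "(\<integral>\<^sup>+t\<in>{0..2*pi}. G (cis t * w) \<partial>lborel) =
      (\<integral>\<^sup>+t. indicator {0..2*pi} t * ennreal ((norm (\<Sum>m. g m w * cis t ^ m))\<^sup>2) \<partial>lborel)"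
      unfolding G_rot by (intro nn_integral_cong) (rule mult.commute)
    also have "\<dots> = (\<integral>\<^sup>+t. ennreal (indicator {0..2*pi} t * (norm (\<Sum>m. g m w * cis t ^ m))\<^sup>2) \<partial>lborel)"
      by (intro nn_integral_cong) (auto simp: indicator_def)
    also have "\<dots> = ennreal (2 * pi * (\<Sum>m. (norm (g m w))\<^sup>2))"
      by (rule nn_integral_has_integral_lebesgue[OF _ P(1)]) simp
    also have "\<dots> = ennreal (2 * pi) * ennreal (\<Sum>m. (norm (g m w))\<^sup>2)"
      by (simp add: ennreal_mult')
    also have "ennreal (\<Sum>m. (norm (g m w))\<^sup>2) = (\<Sum>m. ennreal ((norm (g m w))\<^sup>2))"
      by (intro suminf_ennreal_eq[symmetric] summable_sums summable_norm_square g_summ) auto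
    finally show ?thesis .
  qed
  have "(\<integral>\<^sup>+w. G w \<partial>lborel) * ennreal (2 * pi) = (\<integral>\<^sup>+t\<in>{0..2*pi}. (\<integral>\<^sup>+w. G w \<partial>lborel) \<partial>lborel)"
    by (subst nn_integral_cmult_indicator) auto
  also have "\<dots> = (\<integral>\<^sup>+t\<in>{0..2*pi}. (\<integral>\<^sup>+w. G (cis t * w) \<partial>lborel) \<partial>lborel)"
    by (simp add: nn_integral_lborel_rotate)
  also have "\<dots> = (\<integral>\<^sup>+t. \<integral>\<^sup>+w. G (cis t * w) * indicator {0..2*pi} t \<partial>lborel \<partial>lborel)"
    by (intro nn_integral_cong nn_integral_multc[symmetric]) measurable
  also have "\<dots> = (\<integral>\<^sup>+w. \<integral>\<^sup>+t. G (cis t * w) * indicator {0..2*pi} t \<partial>lborel \<partial>lborel)"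
    by (rule lborel_pair.Fubini') measurable
  also have "\<dots> = (\<integral>\<^sup>+w. ennreal (2 * pi) * (\<Sum>m. ennreal ((norm (g m w))\<^sup>2)) \<partial>lborel)"
    by (simp add: circle)
  also have "\<dots> = ennreal (2 * pi) * (\<Sum>m. \<integral>\<^sup>+w. ennreal ((norm (g m w))\<^sup>2) \<partial>lborel)"
    by (subst nn_integral_cmult) (auto simp: nn_integral_suminf)
  finally have "(\<integral>\<^sup>+w. G w \<partial>lborel) * ennreal (2 * pi) =
      (\<Sum>m. \<integral>\<^sup>+w. ennreal ((norm (g m w))\<^sup>2) \<partial>lborel) * ennreal (2 * pi)"
    by (simp add: mult.commute)
  moreover have "x * ennreal (2 * pi) * ennreal (1 / (2 * pi)) = x" for x
    by (simp add: mult.assoc ennreal_mult'[symmetric])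
  ultimately have "(\<integral>\<^sup>+w. G w \<partial>lborel) = (\<Sum>m. \<integral>\<^sup>+w. ennreal ((norm (g m w))\<^sup>2) \<partial>lborel)"
    by metis
  then show ?thesis unfolding G_eq gm_eq .
qed

lemma nn_integral_disc_term:
  "(\<integral>\<^sup>+w\<in>ball 0 1. ennreal ((norm (b * disc_term k m w))\<^sup>2) \<partial>lborel) =
    ennreal (pi * (real k + 1) * (real k + 2) * (real k + 3) / 3 *
      ((norm b)\<^sup>2 / ((real m + 1) * (real m + 2) * (real m + 3))))"
proof -
  have [measurable]: "radial_coeff k m \<in> borel_measurable borel"
    by (intro borel_measurable_continuous_onI continuous_intros)
  let ?I = "(real k + 1) * (real k + 2) * (real k + 3) / (3 * ((real m + 1) * (real m + 2) * (real m + 3)))"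
  have "(\<integral>\<^sup>+w\<in>ball 0 1. ennreal ((norm (b * disc_term k m w))\<^sup>2) \<partial>lborel) =
      (\<integral>\<^sup>+w\<in>ball (0::complex) 1. ennreal ((norm b)\<^sup>2 * (radial_coeff k m (norm w))\<^sup>2) \<partial>lborel)"
    by (simp add: norm_mult norm_disc_term power_mult_distrib)
  also have "\<dots> = (\<integral>\<^sup>+r\<in>{0..1}. ennreal (2 * pi * r) * ennreal ((norm b)\<^sup>2 * (radial_coeff k m r)\<^sup>2) \<partial>lborel)"
    by (rule nn_integral_radial_disc) measurable
  also have "\<dots> = (\<integral>\<^sup>+r. ennreal (indicator {0..1} r * (pi * (norm b)\<^sup>2 * (2 * r * (radial_coeff k m r)\<^sup>2))) \<partial>lborel)"
    by (intro nn_integral_cong) (auto simp: indicator_def ennreal_mult'[symmetric] mult_ac)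
  also have "\<dots> = ennreal (pi * (norm b)\<^sup>2 * ?I)"
    by (rule nn_integral_has_integral_lebesgue[OF _ has_integral_mult_right[OF radial_coeff_has_integral]]) simp
  also have "pi * (norm b)\<^sup>2 * ?I = pi * (real k + 1) * (real k + 2) * (real k + 3) / 3 *
      ((norm b)\<^sup>2 / ((real m + 1) * (real m + 2) * (real m + 3)))"
    by simp
  finally show ?thesis .
qed

text \<open>Stated for arbitrary \<open>k\<close> because it serves twice: with
  \<open>k = j - 2\<close> for \<open>aw w j\<close> and with \<open>k = 0\<close> for
  \<open>Q\<close>. Finiteness of the extended integral gives integrability and value at
  once.\<close>

lemma disc_series_integral:
  fixes c :: "nat \<Rightarrow> complex"
  assumes c: "\<And>w. norm w < 1 \<Longrightarrow> summable (\<lambda>m. norm (c m * disc_term k m w))"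
    and V: "(\<lambda>m. (norm (c m))\<^sup>2 / ((real m + 1) * (real m + 2) * (real m + 3))) sums V"
  shows "set_integrable lborel unit_disc (\<lambda>w. (norm (\<Sum>m. c m * disc_term k m w))\<^sup>2)"
    and "(LINT w:unit_disc|lborel. (norm (\<Sum>m. c m * disc_term k m w))\<^sup>2) =
      pi * (real k + 1) * (real k + 2) * (real k + 3) / 3 * V"
proof -
  let ?N = "pi * (real k + 1) * (real k + 2) * (real k + 3) / 3"
  have V0: "0 \<le> V" using sums_le[OF _ sums_zero V] by simp
  have "(\<integral>\<^sup>+w. ennreal (indicator unit_disc w *\<^sub>R (norm (\<Sum>m. c m * disc_term k m w))\<^sup>2) \<partial>lborel) =
     (\<integral>\<^sup>+w\<in>unit_disc. ennreal ((norm (\<Sum>m. c m * disc_term k m w))\<^sup>2) \<partial>lborel)"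
    by (intro nn_integral_cong) (auto simp: indicator_def)
  also have "\<dots> = (\<Sum>m. \<integral>\<^sup>+w\<in>ball 0 1. ennreal ((norm (c m * disc_term k m w))\<^sup>2) \<partial>lborel)"
    by (rule nn_integral_disc_Parseval[where k = k])
      (use c in \<open>simp_all add: disc_term_rotate\<close>)
  also have "\<dots> = ennreal (?N * V)"
    unfolding nn_integral_disc_term by (intro suminf_ennreal_eq sums_mult V) simp
  finally have nn: "(\<integral>\<^sup>+w. ennreal (indicator unit_disc w *\<^sub>R (norm (\<Sum>m. c m * disc_term k m w))\<^sup>2) \<partial>lborel) =
    ennreal (?N * V)" .
  have [measurable]: "(indicator unit_disc :: complex \<Rightarrow> real) \<in> borel_measurable borel"
    by (intro borel_measurable_indicator) simp
  have "has_bochner_integral lborel (\<lambda>w. indicator unit_disc w *\<^sub>R (norm (\<Sum>m. c m * disc_term k m w))\<^sup>2) (?N * V)"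
    by (rule has_bochner_integral_nn_integral[OF _ _ _ nn]) (use V0 in auto)
  then show "set_integrable lborel unit_disc (\<lambda>w. (norm (\<Sum>m. c m * disc_term k m w))\<^sup>2)"
    "(LINT w:unit_disc|lborel. (norm (\<Sum>m. c m * disc_term k m w))\<^sup>2) = ?N * V"
    unfolding set_integrable_def set_lebesgue_integral_def has_bochner_integral_iff by auto
qed

section \<open>The Taylor series of \<open>Q\<close> and the comparison of the three
  quantities\<close>

lemma third_deriv_sums:
  fixes a :: "nat \<Rightarrow> complex"
  assumes u: "\<And>z. norm z < 1 \<Longrightarrow> (\<lambda>m. a (m + 1) * z ^ (m + 2)) sums u z" and z: "norm z < 1"
  shows "(\<lambda>m. of_nat ((m + 1) * (m + 2) * (m + 3)) * a (m + 2) * z ^ m) sums (deriv ^^ 3) u z"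
proof -
  \<comment> \<open>The coefficient of \<open>z ^ m\<close> in \<open>u\<close>: the series of
    \<open>u\<close> starts with \<open>a 1\<close> at \<open>z ^ 2\<close>, hence the shift by one
    and the two zeros.\<close>
  define d where "d m = (if m < 2 then 0 else a (m - 1))" for m
  have "(\<lambda>m. d m * z ^ m) sums u z" if "norm z < 1" for z
  proof -
    have "(\<lambda>m. d (m + 2) * z ^ (m + 2)) sums u z"
      using u[OF that] by (simp add: d_def)
    then show ?thesis
      by (subst (asm) sums_iff_shift) (simp add: d_def eval_nat_numeral)
  qed
  \<comment> \<open>The factor 6 is \<open>fact 3\<close>. The binomial \<open>m choose 3\<close>
    removes the terms with \<open>m < 3\<close>, and with them \<open>a 1\<close>.\<close>
  from sums_mult[OF higher_deriv_sums(1)[OF this z, of 3], of 6]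
  have "(\<lambda>m. 6 * (of_nat (m choose 3) * d m * z ^ (m - 3))) sums (deriv ^^ 3) u z"
    by (simp add: fact_numeral)
  then have "(\<lambda>m. 6 * (of_nat ((m + 3) choose 3) * d (m + 3) * z ^ (m + 3 - 3))) sums (deriv ^^ 3) u z"
    by (subst sums_iff_shift) (simp add: eval_nat_numeral)
  moreover have "6 * (of_nat ((m + 3) choose 3) * d (m + 3) * z ^ (m + 3 - 3)) =
     of_nat ((m + 1) * (m + 2) * (m + 3)) * a (m + 2) * z ^ m" for m
  proof -
    have "6 * ((m + 3) choose 3) = (m + 1) * (m + 2) * (m + 3)"
    proof -
      have 3: "3 * ((m + 3) choose 3) = (m + 3) * ((m + 2) choose 2)"
        using Suc_times_binomial[of 2 "m + 2"] by (simp add: eval_nat_numeral del: binomial_Suc_Suc)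
      have 2: "2 * ((m + 2) choose 2) = (m + 2) * (m + 1)"
        using Suc_times_binomial[of 1 "m + 1"] by (simp add: eval_nat_numeral del: binomial_Suc_Suc)
      have "6 * ((m + 3) choose 3) = 2 * (3 * ((m + 3) choose 3))" by simp
      also have "\<dots> = (m + 3) * (2 * ((m + 2) choose 2))" unfolding 3 by (simp only: mult_ac)
      also have "\<dots> = (m + 1) * (m + 2) * (m + 3)" unfolding 2 by (simp only: mult_ac)
      finally show ?thesis .
    qed
    then have "6 * of_nat ((m + 3) choose 3) = (of_nat ((m + 1) * (m + 2) * (m + 3)) :: complex)"
      by (metis of_nat_mult of_nat_numeral)
    moreover have "d (m + 3) = a (m + 2)" by (simp add: d_def)
    ultimately show ?thesis by (simp only: mult.assoc[symmetric]) simp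
  qed
  ultimately show ?thesis by (simp only:)
qed

theorem theorem4p2:
  fixes a :: "nat \<Rightarrow> complex" and u Q :: "complex \<Rightarrow> complex"
    and aw :: "complex \<Rightarrow> nat \<Rightarrow> complex" and j :: nat
  assumes u_hol: "u holomorphic_on unit_disc"
    and u_series: "\<And>z. z \<in> unit_disc \<Longrightarrow> (\<lambda>m. a (m + 1) * z ^ (m + 2)) sums u z"
    and u_H32: "summable (\<lambda>m. real (m + 1) ^ 3 * (norm (a (m + 1)))\<^sup>2)"
    and Q: "Q = (deriv ^^ 3) u"
    and aw: "pullback_coeffs Q aw"
    and j: "j \<ge> 2"
  shows "set_integrable lborel unit_disc (\<lambda>w. (norm (aw w j))\<^sup>2 * (4 / (1 - (norm w)\<^sup>2)\<^sup>2))
     \<and> set_integrable lborel unit_disc (\<lambda>w. (norm (Q w))\<^sup>2 * (1 - (norm w)\<^sup>2)\<^sup>2)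
     \<and> summable (\<lambda>m. (real (m + 2) ^ 3 - real (m + 2)) * (norm (a (m + 2)))\<^sup>2)
     \<and> ((LINT w:unit_disc|lborel. (norm (aw w j))\<^sup>2 * (4 / (1 - (norm w)\<^sup>2)\<^sup>2))
       = 2 / (3 * (real j ^ 3 - real j))
           * (LINT w:unit_disc|lborel. (norm (Q w))\<^sup>2 * (1 - (norm w)\<^sup>2)\<^sup>2))
     \<and> (2 / (3 * (real j ^ 3 - real j))
           * (LINT w:unit_disc|lborel. (norm (Q w))\<^sup>2 * (1 - (norm w)\<^sup>2)\<^sup>2)
       = 4 * pi / (3 * (real j ^ 3 - real j))
           * (\<Sum>m. (real (m + 2) ^ 3 - real (m + 2)) * (norm (a (m + 2)))\<^sup>2))"
proof -
  define k where "k = j - 2"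
  have j_eq: "j = k + 2" using j by (simp add: k_def)
  have cubic: "real (m + 2) ^ 3 - real (m + 2) = (real m + 1) * (real m + 2) * (real m + 3)" for m
    by (simp add: power3_eq_cube algebra_simps)
  define N where "N = real j ^ 3 - real j"
  have N: "N = (real k + 1) * (real k + 2) * (real k + 3)"
    unfolding N_def j_eq cubic ..
  have N_pos: "N > 0" unfolding N by simp
  define c where "c m = of_nat ((m + 1) * (m + 2) * (m + 3)) * a (m + 2)" for m
  have norm_c: "norm (c m) = (real m + 1) * (real m + 2) * (real m + 3) * norm (a (m + 2))" for m
    unfolding c_def norm_mult norm_of_nat by (simp add: algebra_simps)
  have c_sums: "(\<lambda>m. c m * z ^ m) sums Q z" if "norm z < 1" for z
    unfolding c_def Q by (rule third_deriv_sums) (use u_series that in auto)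
  define S where "S = (\<Sum>m. (real (m + 2) ^ 3 - real (m + 2)) * (norm (a (m + 2)))\<^sup>2)"
  have summ: "summable (\<lambda>m. (real (m + 2) ^ 3 - real (m + 2)) * (norm (a (m + 2)))\<^sup>2)"
  proof (rule summable_comparison_test)
    \<comment> \<open>The hypothesis sums from \<open>a 1\<close>, the majorant from
      \<open>a 2\<close>.\<close>
    show "summable (\<lambda>m. real (m + 2) ^ 3 * (norm (a (m + 2)))\<^sup>2)"
      using u_H32 by (subst (asm) summable_Suc_iff[symmetric]) (simp add: add.commute)
    show "\<exists>N. \<forall>m\<ge>N. norm ((real (m + 2) ^ 3 - real (m + 2)) * (norm (a (m + 2)))\<^sup>2)
        \<le> real (m + 2) ^ 3 * (norm (a (m + 2)))\<^sup>2"
    proof (intro exI allI impI)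
      fix m
      have "0 \<le> real (m + 2) ^ 3 - real (m + 2)" unfolding cubic by simp
      then show "norm ((real (m + 2) ^ 3 - real (m + 2)) * (norm (a (m + 2)))\<^sup>2)
        \<le> real (m + 2) ^ 3 * (norm (a (m + 2)))\<^sup>2"
        unfolding real_norm_def abs_mult by (intro mult_mono) auto
    qed
  qed
  \<comment> \<open>The cubic factor enters squared through \<open>c m\<close> and is divided out
    once by the integral of the m-th term, which leaves the summand of the theorem.\<close>
  have "(norm (c m))\<^sup>2 / ((real m + 1) * (real m + 2) * (real m + 3)) =
      (real (m + 2) ^ 3 - real (m + 2)) * (norm (a (m + 2)))\<^sup>2" for m
  proof -
    have "(x * y)\<^sup>2 / x = x * y\<^sup>2" if "x \<noteq> 0" for x y :: real
      using that by (simp add: power2_eq_square)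
    moreover have "(real m + 1) * (real m + 2) * (real m + 3) \<noteq> 0" by simp
    ultimately show ?thesis unfolding norm_c cubic by blast
  qed
  then have S: "(\<lambda>m. (norm (c m))\<^sup>2 / ((real m + 1) * (real m + 2) * (real m + 3))) sums S"
    unfolding S_def using summable_sums[OF summ] by (simp only:)
  note int = disc_series_integral[OF disc_term_sums(1)[OF c_sums] S]

  have aw_eq: "(norm (aw w j))\<^sup>2 * (4 / (1 - (norm w)\<^sup>2)\<^sup>2) =
      4 / N\<^sup>2 * (norm (\<Sum>m. c m * disc_term k m w))\<^sup>2" if w: "w \<in> unit_disc" for w
  proof -
    \<comment> \<open>Positivity on the open disc is what allows the weight to be cancelled; outside
      it the integrands are not compared.\<close>
    have s: "1 - (norm w)\<^sup>2 > 0" using w by (simp add: power_less_one_iff abs_square_less_1)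
    have "complex_of_real N * aw w j = of_real (1 - (norm w)\<^sup>2) * (\<Sum>m. c m * disc_term k m w)"
      using disc_term_sums(2)[OF c_sums _ aw, of w k] w by (simp add: N_def j_eq)
    then have "norm (complex_of_real N * aw w j) = norm (complex_of_real (1 - (norm w)\<^sup>2) * (\<Sum>m. c m * disc_term k m w))"
      by (rule arg_cong)
    then have "N * norm (aw w j) = (1 - (norm w)\<^sup>2) * norm (\<Sum>m. c m * disc_term k m w)"
      unfolding norm_mult norm_of_real using N_pos s by simp
    then have "norm (aw w j) = (1 - (norm w)\<^sup>2) * norm (\<Sum>m. c m * disc_term k m w) / N"
      using N_pos by (simp add: field_simps)
    then show ?thesis using s by (simp add: power_mult_distrib power_divide)
  qed
  have aw_int: "set_integrable lborel unit_disc (\<lambda>w. (norm (aw w j))\<^sup>2 * (4 / (1 - (norm w)\<^sup>2)\<^sup>2))"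
    by (rule iffD2[OF set_integrable_cong[OF refl refl aw_eq] set_integrable_mult_right[OF int(1)]])
  have aw_val: "(LINT w:unit_disc|lborel. (norm (aw w j))\<^sup>2 * (4 / (1 - (norm w)\<^sup>2)\<^sup>2)) = 4 * pi / (3 * N) * S"
  proof -
    have "(LINT w:unit_disc|lborel. (norm (aw w j))\<^sup>2 * (4 / (1 - (norm w)\<^sup>2)\<^sup>2)) =
       (LINT w:unit_disc|lborel. 4 / N\<^sup>2 * (norm (\<Sum>m. c m * disc_term k m w))\<^sup>2)"
      by (rule set_lebesgue_integral_cong) (simp, use aw_eq in blast)
    also have "\<dots> = 4 / N\<^sup>2 * (LINT w:unit_disc|lborel. (norm (\<Sum>m. c m * disc_term k m w))\<^sup>2)"
      by (rule set_integral_mult_right)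
    also have "(LINT w:unit_disc|lborel. (norm (\<Sum>m. c m * disc_term k m w))\<^sup>2) =
        pi * (real k + 1) * (real k + 2) * (real k + 3) / 3 * S" by (rule int(2))
    also have "\<dots> = pi * N / 3 * S" unfolding N by (simp only: mult.assoc)
    also have "4 / N\<^sup>2 * (pi * N / 3 * S) = 4 * pi / (3 * N) * S" using N_pos by (simp add: power2_eq_square)
    finally show ?thesis .
  qed

  \<comment> \<open>For \<open>k = 0\<close> the weight stays inside: each
    \<open>disc_term 0 m w\<close> carries the factor \<open>1 - |w|^2\<close>, which comes out of
    the series and is squared with it.\<close>
  have Q_eq: "(norm (Q w))\<^sup>2 * (1 - (norm w)\<^sup>2)\<^sup>2 = (norm (\<Sum>m. c m * disc_term 0 m w))\<^sup>2"
    if w: "w \<in> unit_disc" for w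
  proof -
    have "(\<lambda>m. of_real (1 - (norm w)\<^sup>2) * (c m * w ^ m)) sums (of_real (1 - (norm w)\<^sup>2) * Q w)"
      using w by (intro sums_mult c_sums) simp
    then have eq: "(\<Sum>m. c m * disc_term 0 m w) = of_real (1 - (norm w)\<^sup>2) * Q w"
      unfolding disc_term_zero by (simp only: mult.left_commute sums_iff)
    show ?thesis unfolding eq norm_mult norm_of_real power_mult_distrib power2_abs by (rule mult.commute)
  qed
  have Q_int: "set_integrable lborel unit_disc (\<lambda>w. (norm (Q w))\<^sup>2 * (1 - (norm w)\<^sup>2)\<^sup>2)"
    by (rule iffD2[OF set_integrable_cong[OF refl refl Q_eq] int(1)])
  have Q_val: "(LINT w:unit_disc|lborel. (norm (Q w))\<^sup>2 * (1 - (norm w)\<^sup>2)\<^sup>2) = 2 * pi * S"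
  proof -
    have "(LINT w:unit_disc|lborel. (norm (Q w))\<^sup>2 * (1 - (norm w)\<^sup>2)\<^sup>2) =
        (LINT w:unit_disc|lborel. (norm (\<Sum>m. c m * disc_term 0 m w))\<^sup>2)"
      by (rule set_lebesgue_integral_cong) (simp, use Q_eq in blast)
    also have "\<dots> = pi * (real 0 + 1) * (real 0 + 2) * (real 0 + 3) / 3 * S" by (rule int(2))
    also have "\<dots> = 2 * pi * S" by simp
    finally show ?thesis .
  qed
  show ?thesis
    unfolding S_def[symmetric] N_def[symmetric] aw_val Q_val
    using aw_int Q_int summ by simp
qed

end
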